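(* Let $r \geq 4$ be a fixed integer. Then, as $n \to \infty$, with high probability $$\alpha\big(G_{1/2}(n,r,1)\big) = \binom{n-2}{r-2}.$$
   Context: For integers $n, r, s$, the graph $G(n,r,s)$ has vertex set $\binom{[n]}{r}$ (all $r$-element subsets of $[n]=\{1,\dots,n\}$), and two vertices $A,B$ are adjacent iff $|A\cap B| = s$. For $p\in[0,1]$, $G_p(n,r,s)$ denotes the random graph obtained from $G(n,r,s)$ by deleting each edge independently with probability $1-p$. $\alpha(G)$ is the independence number of $G$. "With high probability" (w.h.p.) means with probability tending to $1$ as $n\to\infty$. *)

theory Defs
  imports "HOL-Probability.Probability"
begin

type_synonym 'v graph = "'v set \<times> 'v set set"

definition independent_set :: "'v graph \<Rightarrow> 'v set \<Rightarrow> bool" where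
  "independent_set G S \<longleftrightarrow> S \<subseteq> fst G \<and> (\<forall>x\<in>S. \<forall>y\<in>S. {x, y} \<notin> snd G)"

text \<open>Meaningful for graphs with a finite vertex set, as \<^const>\<open>Max\<close> requires.\<close>

definition independence_number :: "'v graph \<Rightarrow> nat" where
  "independence_number G = Max (card ` {S. independent_set G S})"

text \<open>The condition \<open>A \<noteq> B\<close> only matters for \<open>s = r\<close>, where it excludes loops.\<close>

definition intersection_graph :: "nat \<Rightarrow> nat \<Rightarrow> nat \<Rightarrow> nat set graph" where
  "intersection_graph n r s =
     (let V = {A. A \<subseteq> {1..n} \<and> card A = r}
      in (V, {{A, B} | A B. A \<in> V \<and> B \<in> V \<and> A \<noteq> B \<and> card (A \<inter> B) = s}))"

text \<open>
  \<open>X e\<close> says that the edge \<open>e\<close> survives; the family of the \<open>X e\<close>, with \<open>e\<close> ranging over the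
  (finitely many) edges, is independent, each being true with probability \<open>p\<close>.
\<close>

definition random_subgraph :: "real \<Rightarrow> 'v graph \<Rightarrow> 'v graph pmf" where
  "random_subgraph p G =
     map_pmf (\<lambda>X. (fst G, {e \<in> snd G. X e}))
       (Pi_pmf (snd G) False (\<lambda>_. bernoulli_pmf p))"

end

theory Submission
  imports Defs "HOL-Real_Asymp.Real_Asymp"
begin

text \<open>
  Let m = C(n - 2, r - 2), the size of the star of all r-sets through a fixed pair. The key fact is
  deterministic: for L of logarithmic size, every family F of m + 1 sets has a pair p such that F spans
  at least a constant times L k edges, where k is the number of members of F outside the star of p.
  The union bound over all F then converges: the families at a given distance from a star are few
  enough, since F is determined by p and its symmetric difference with the star, which has size 2 k - 1.

  For the key fact, consider a family of maximum degree at most L. Call T a kernel if the sets through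
  T cannot be blocked by M = r (L + 1) further points. No member meets a kernel in exactly one point,
  nor do two kernels. Hence kernel pairs are disjoint and, apart from few exceptions, each point of a
  member lies in a kernel pair or triple inside that member. It follows that all but O(M^3 n^(r-3))
  members either consist of a kernel pair p and points c for which p + c is a kernel (these books are
  disjoint for different p) or, when r = 4, are the union of two kernel pairs. Counting shows that a
  family of size close to m is close to a star.

  Finally, suppose that most of the k members outside the star have small degree. They avoid p, and
  if z points are covered by them, then their neighbourhoods in the star, which are almost absent from
  F, have total size at least a constant times z n^(r-3), whereas the structure on z points allows
  only a small multiple of z n^(r-3) such members when z is small compared with n.
\<close>

subsection \<open>Counting sets\<close>

text \<open>Such a set is \<open>Y\<close> together with a free choice of \<open>r - card Y\<close>
  points outside \<open>X\<close>. Later this counts the members of a star that meet a given set in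
  prescribed points.\<close>

lemma card_subsets_with_trace:
  assumes "finite Z" "X \<subseteq> Z" "Y \<subseteq> X" "card Y \<le> r"
  shows "card {A. A \<subseteq> Z \<and> card A = r \<and> A \<inter> X = Y} = (card Z - card X) choose (r - card Y)"
proof -
  have fin: "finite X" "finite Y"
    using finite_subset[OF assms(2,1)] finite_subset[OF assms(3)] by auto
  have "bij_betw (\<lambda>R. Y \<union> R) {R. R \<subseteq> Z - X \<and> card R = r - card Y}
          {A. A \<subseteq> Z \<and> card A = r \<and> A \<inter> X = Y}"
  proof (rule bij_betw_byWitness[where f' = "\<lambda>A. A - X"])
    show "(\<lambda>R. Y \<union> R) ` {R. R \<subseteq> Z - X \<and> card R = r - card Y}
            \<subseteq> {A. A \<subseteq> Z \<and> card A = r \<and> A \<inter> X = Y}"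
    proof clarify
      fix R assume R: "R \<subseteq> Z - X" "card R = r - card Y"
      have "card (Y \<union> R) = card Y + card R"
        using R fin assms(1,3) by (intro card_Un_disjoint) (auto intro: finite_subset)
      then show "Y \<union> R \<subseteq> Z \<and> card (Y \<union> R) = r \<and> (Y \<union> R) \<inter> X = Y"
        using R assms by auto
    qed
    show "(\<lambda>A. A - X) ` {A. A \<subseteq> Z \<and> card A = r \<and> A \<inter> X = Y}
            \<subseteq> {R. R \<subseteq> Z - X \<and> card R = r - card Y}"
    proof clarify
      fix A assume A: "A \<subseteq> Z" "r = card A" "Y = A \<inter> X"
      have "card (A - X) = card A - card (A \<inter> X)"
        using fin by (intro card_Diff_subset_Int) auto
      then show "A - X \<subseteq> Z - X \<and> card (A - X) = card A - card (A \<inter> X)"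
        using A by auto
    qed
  qed (use assms in auto)
  then have "card {A. A \<subseteq> Z \<and> card A = r \<and> A \<inter> X = Y} = card {R. R \<subseteq> Z - X \<and> card R = r - card Y}"
    by (rule bij_betw_same_card[symmetric])
  also have "\<dots> = card (Z - X) choose (r - card Y)"
    using assms by (intro n_subsets) auto
  finally show ?thesis
    using assms fin by (simp add: card_Diff_subset)
qed

lemma choose_le_power: "n choose k \<le> n ^ k" for n k :: nat
  using binomial_le_pow[of k n] by (cases "k \<le> n") (auto simp: binomial_eq_0)

text \<open>A member is a set from \<open>QQ\<close> with \<open>j + 3\<close> points plus
  \<open>r - (j + 3)\<close> free points, so the exponents add up to \<open>r - 3\<close> for every
  \<open>j\<close>. A configuration is thus negligible once it has three more points than degrees of
  freedom.\<close>

lemma card_le_of_containing: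
  assumes "finite Z" "finite QQ" "F \<subseteq> {A. A \<subseteq> Z \<and> card A = r}"
    and "\<And>A. A \<in> F \<Longrightarrow> \<exists>Q\<in>QQ. Q \<subseteq> A \<and> card Q = j + 3"
    and "card QQ \<le> K * card Z ^ j"
  shows "card F \<le> K * card Z ^ (r - 3)"
proof (cases "j + 3 \<le> r")
  case True
  let ?R = "{R. R \<subseteq> Z \<and> card R = r - (j + 3)}"
  have finR: "finite ?R"
    using assms(1) by simp
  have "F \<subseteq> (\<lambda>(Q, R). Q \<union> R) ` (QQ \<times> ?R)"
  proof
    fix A assume A: "A \<in> F"
    then obtain Q where Q: "Q \<in> QQ" "Q \<subseteq> A" "card Q = j + 3"
      using assms(4) by blast
    have "card (A - Q) = r - (j + 3)" "A \<subseteq> Z"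
      using Q A assms(1,3) by (auto simp: card_Diff_subset finite_subset)
    then have "(Q, A - Q) \<in> QQ \<times> ?R"
      using Q by auto
    moreover have "A = (\<lambda>(Q, R). Q \<union> R) (Q, A - Q)"
      using Q by auto
    ultimately show "A \<in> (\<lambda>(Q, R). Q \<union> R) ` (QQ \<times> ?R)"
      by (rule rev_image_eqI)
  qed
  then have "card F \<le> card (QQ \<times> ?R)"
    using finR assms(2) by (intro surj_card_le) auto
  also have "\<dots> = card QQ * (card Z choose (r - (j + 3)))"
    using assms(1) by (simp add: card_cartesian_product n_subsets)
  also have "\<dots> \<le> (K * card Z ^ j) * card Z ^ (r - (j + 3))"
    using assms(5) choose_le_power by (intro mult_mono) auto
  also have "\<dots> = K * card Z ^ (r - 3)"
    using True by (simp add: mult.assoc flip: power_add)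
  finally show ?thesis .
next
  \<comment> \<open>Here \<open>r - (j + 3)\<close> would truncate, but no set of size
    \<open>r\<close> contains more than \<open>r\<close> points.\<close>
  case False
  have "F = {}"
  proof (rule ccontr)
    assume "F \<noteq> {}"
    then obtain A where A: "A \<in> F" by blast
    then obtain Q where "Q \<subseteq> A" "card Q = j + 3"
      using assms(4) by blast
    moreover have "finite A" "card A = r"
      using A assms(1,3) by (auto intro: finite_subset)
    ultimately show False
      using False card_mono[of A Q] by simp
  qed
  then show ?thesis by simp
qed

lemma card_UN_le_mult:
  assumes "finite I" "\<And>i. i \<in> I \<Longrightarrow> card (f i) \<le> k"
  shows "card (\<Union>i\<in>I. f i) \<le> card I * k"
proof -
  have "card (\<Union>i\<in>I. f i) \<le> (\<Sum>i\<in>I. card (f i))"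
    using assms(1) by (rule card_UN_le)
  also have "\<dots> \<le> card I * k"
    using sum_bounded_above[of I "\<lambda>i. card (f i)" k] assms(2) by simp
  finally show ?thesis .
qed

lemma sum_power_Suc_le:
  fixes f :: "'a \<Rightarrow> 'b :: linordered_semidom"
  assumes "\<And>i. i \<in> I \<Longrightarrow> 0 \<le> f i" "\<And>i. i \<in> I \<Longrightarrow> f i \<le> c"
  shows "(\<Sum>i\<in>I. f i ^ Suc k) \<le> c ^ k * (\<Sum>i\<in>I. f i)"
  unfolding sum_distrib_left power_Suc2
  using assms by (intro sum_mono mult_right_mono power_mono)

subsection \<open>Kernels of families of small maximum degree\<close>

locale sparse_family =
  fixes Z :: "'a set" and F :: "'a set set" and r d :: nat
  assumes finite_ground: "finite Z"
    and uniform: "F \<subseteq> {A. A \<subseteq> Z \<and> card A = r}"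
    and r_ge_4: "4 \<le> r"
    and degree_le: "A \<in> F \<Longrightarrow> card {B \<in> F. card (A \<inter> B) = 1} \<le> d"
begin

text \<open>A bound for the number of points covered by a member together with its at most
  \<open>d\<close> neighbours.\<close>

definition M :: nat where "M = r * (d + 1)"

text \<open>A robust form of being the kernel of a large sunflower: the link of T has no cover by M points.\<close>

definition kernel :: "'a set \<Rightarrow> bool" where
  "kernel T \<longleftrightarrow> (\<forall>W. finite W \<and> card W \<le> M \<longrightarrow> (\<exists>A\<in>F. T \<subseteq> A \<and> A \<inter> W \<subseteq> T))"

text \<open>For a non-kernel this is a chosen witness of the failure; the value \<open>{}\<close> on
  kernels makes finiteness and the bound \<open>M\<close> hold for every \<open>T\<close>.\<close>

definition cover :: "'a set \<Rightarrow> 'a set" where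
  "cover T = (if kernel T then {}
     else (SOME W. finite W \<and> card W \<le> M \<and> (\<forall>A\<in>F. T \<subseteq> A \<longrightarrow> \<not> A \<inter> W \<subseteq> T)))"

lemma M_ge: "4 \<le> M"
  using mult_le_mono[OF r_ge_4, of 1 "d + 1"] by (simp add: M_def)

lemma finite_family: "finite F"
  by (rule finite_subset[OF uniform]) (simp add: finite_ground)

lemma member: "A \<in> F \<Longrightarrow> A \<subseteq> Z" "A \<in> F \<Longrightarrow> card A = r" "A \<in> F \<Longrightarrow> finite A"
  using uniform finite_subset[OF _ finite_ground] by auto

lemma
  shows finite_cover: "finite (cover T)" and card_cover: "card (cover T) \<le> M"
    and cover_hits: "\<lbrakk>\<not> kernel T; A \<in> F; T \<subseteq> A\<rbrakk> \<Longrightarrow> \<exists>w\<in>cover T. w \<in> A \<and> w \<notin> T"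
proof -
  have *: "finite (cover T) \<and> card (cover T) \<le> M \<and> (\<forall>A\<in>F. T \<subseteq> A \<longrightarrow> \<not> A \<inter> cover T \<subseteq> T)"
    if "\<not> kernel T"
  proof -
    have "\<exists>W. finite W \<and> card W \<le> M \<and> (\<forall>A\<in>F. T \<subseteq> A \<longrightarrow> \<not> A \<inter> W \<subseteq> T)"
      using that unfolding kernel_def by blast
    from someI_ex[OF this] show ?thesis
      using that by (simp add: cover_def)
  qed
  show "finite (cover T)" "card (cover T) \<le> M"
    using * by (cases "kernel T"; simp add: cover_def)+
  show "\<exists>w\<in>cover T. w \<in> A \<and> w \<notin> T" if "\<not> kernel T" "A \<in> F" "T \<subseteq> A"
    using * that by blast
qed

lemma kernel_obtain:
  assumes "kernel T" "finite W" "card W \<le> M"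
  obtains A where "A \<in> F" "T \<subseteq> A" "A \<inter> W \<subseteq> T"
  using assms unfolding kernel_def by blast

lemma kernel_subset: "kernel T \<Longrightarrow> T \<subseteq> Z"
  by (rule kernel_obtain[of T "{}"]) (auto dest: member(1))

lemma finite_kernel: "kernel T \<Longrightarrow> finite T"
  using finite_subset[OF kernel_subset finite_ground] .

text \<open>The members of the family at hand are the neighbours of X, which cover at most M points;
  a member through T avoiding them would be a further neighbour.\<close>

lemma kernel_member_inter:
  assumes "kernel T" "card T < r" "X \<in> F"
  shows "card (X \<inter> T) \<noteq> 1"
proof
  assume 1: "card (X \<inter> T) = 1"
  let ?N = "{B \<in> F. card (X \<inter> B) = 1}"
  let ?W = "X \<union> \<Union>?N"
  have "card (\<Union>?N) \<le> card ?N * r"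
    using card_UN_le_mult[of ?N "\<lambda>x. x" r] finite_family member by simp
  also have "\<dots> \<le> d * r"
    using degree_le[OF assms(3)] by simp
  finally have "card ?W \<le> M"
    using card_Un_le[of X "\<Union>?N"] member(2)[OF assms(3)] by (simp add: M_def algebra_simps)
  moreover have "finite ?W"
    using member finite_family assms(3) by auto
  ultimately obtain A where A: "A \<in> F" "T \<subseteq> A" "A \<inter> ?W \<subseteq> T"
    using kernel_obtain[OF assms(1)] by blast
  then have "X \<inter> A = X \<inter> T"
    by blast
  then have "A \<in> ?N"
    using A 1 by simp
  then have "A \<subseteq> T"
    using A by blast
  then show False
    using A member(2) assms(2) by (metis less_irrefl subset_antisym)
qed

text \<open>Since \<open>T\<close> has at most \<open>M\<close> points, some member through
  \<open>T'\<close> avoids the rest of \<open>T\<close>. It meets \<open>T\<close> exactly in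
  \<open>T \<inter> T'\<close>, which reduces the claim to a kernel and a member.\<close>

lemma kernel_inter:
  assumes "kernel T" "kernel T'" "card T < r" "card T' < r"
  shows "card (T \<inter> T') \<noteq> 1"
proof -
  have "card T \<le> M"
    using assms(3) by (simp add: M_def trans_le_add1)
  then obtain A where A: "A \<in> F" "T' \<subseteq> A" "A \<inter> T \<subseteq> T'"
    using kernel_obtain[OF assms(2) finite_kernel[OF assms(1)]] by blast
  then have "A \<inter> T = T \<inter> T'"
    by blast
  then show ?thesis
    using kernel_member_inter[OF assms(1,3) A(1)] by simp
qed

text \<open>A kernel lies in some member, and that member would meet \<open>{x}\<close> in exactly
  one point.\<close>

lemma not_kernel_singleton: "\<not> kernel {x}"
proof
  assume k: "kernel {x}"
  then obtain A where "A \<in> F" "{x} \<subseteq> A"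
    using kernel_obtain[OF k, of "{}"] by auto
  then show False
    using kernel_member_inter[OF k, of A] r_ge_4 by simp
qed

text \<open>Otherwise some member through \<open>insert c T\<close> would evade the cover of
  \<open>T\<close>. Hence at most \<open>M\<close> points turn a non-kernel into a kernel.\<close>

lemma kernel_insert_in_cover:
  assumes "\<not> kernel T" "kernel (insert c T)"
  shows "c \<in> cover T"
proof (rule ccontr)
  assume c: "c \<notin> cover T"
  obtain A where A: "A \<in> F" "insert c T \<subseteq> A" "A \<inter> cover T \<subseteq> insert c T"
    using kernel_obtain[OF assms(2) finite_cover card_cover] by blast
  moreover obtain w where "w \<in> cover T" "w \<in> A" "w \<notin> T"
    using cover_hits[OF assms(1) A(1)] A(2) by blast
  ultimately show False
    using c by blast
qed

text \<open>One level of branching: a member through a non-kernel of \<open>TT\<close> contains one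
  of the new sets, and the number of sets grows by a factor of at most \<open>M\<close>.\<close>

definition extend :: "'a set set \<Rightarrow> 'a set set" where
  "extend TT = (\<Union>T\<in>TT. (\<lambda>w. insert w T) ` cover T)"

lemma finite_extend: "finite TT \<Longrightarrow> finite (extend TT)"
  by (auto simp: extend_def finite_cover)

lemma card_extend: "finite TT \<Longrightarrow> card (extend TT) \<le> card TT * M"
  unfolding extend_def
  by (intro card_UN_le_mult order_trans[OF card_image_le[OF finite_cover] card_cover])

lemma extend_step:
  assumes "T \<in> TT" "\<not> kernel T" "A \<in> F" "T \<subseteq> A"
  obtains w where "w \<in> A" "w \<notin> T" "insert w T \<in> extend TT"
  using cover_hits[OF assms(2-4)] assms(1) unfolding extend_def by blast

definition unsupported :: "'a set set" where
  "unsupported = {A \<in> F. \<exists>x\<in>A. \<forall>T. x \<in> T \<and> T \<subseteq> A \<and> (card T = 2 \<or> card T = 3) \<longrightarrow> \<not> kernel T}"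

text \<open>Start from a point \<open>x\<close> of the member that lies in no kernel pair or triple
  inside it. Three rounds of branching never meet a kernel and end in a subset with four points;
  only linearly many sets arise in this way.\<close>

lemma card_unsupported: "card unsupported \<le> M ^ 3 * card Z ^ (r - 3)"
proof -
  let ?S = "(\<lambda>x. {x}) ` Z"
  let ?Q = "extend (extend (extend ?S))"
  have fin: "finite ?S" "finite (extend ?S)" "finite (extend (extend ?S))" "finite ?Q"
    using finite_ground by (auto intro!: finite_extend)
  have "card ?Q \<le> card (extend (extend ?S)) * M"
    using fin by (intro card_extend)
  also have "\<dots> \<le> (card (extend ?S) * M) * M"
    using fin by (intro mult_right_mono card_extend) auto
  also have "\<dots> \<le> ((card ?S * M) * M) * M"
    using fin by (intro mult_right_mono card_extend) auto
  also have "\<dots> \<le> M ^ 3 * card Z ^ 1"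
    using card_image_le[OF finite_ground, of "\<lambda>x. {x}"] by (simp add: power3_eq_cube ac_simps)
  finally have cQ: "card ?Q \<le> M ^ 3 * card Z ^ 1" .
  have "\<exists>Q\<in>?Q. Q \<subseteq> A \<and> card Q = 1 + 3" if "A \<in> unsupported" for A
  proof -
    from that obtain x where x: "A \<in> F" "x \<in> A"
      "\<And>T. \<lbrakk>x \<in> T; T \<subseteq> A; card T = 2 \<or> card T = 3\<rbrakk> \<Longrightarrow> \<not> kernel T"
      unfolding unsupported_def by blast
    have "{x} \<in> ?S"
      using x member(1) by blast
    then obtain y where y: "y \<in> A" "y \<notin> {x}" "{y, x} \<in> extend ?S"
      using extend_step[OF _ not_kernel_singleton, of x ?S A] x(1,2) by auto
    have "\<not> kernel {y, x}"
      using x y by simp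
    then obtain w where w: "w \<in> A" "w \<notin> {y, x}" "{w, y, x} \<in> extend (extend ?S)"
      using extend_step[OF y(3), of A] x y by auto
    have "\<not> kernel {w, y, x}"
      using x y w by simp
    then obtain u where u: "u \<in> A" "u \<notin> {w, y, x}" "{u, w, y, x} \<in> ?Q"
      using extend_step[OF w(3), of A] x y w by auto
    show ?thesis
      using x y w u by (intro bexI[OF _ u(3)]) auto
  qed
  moreover have "unsupported \<subseteq> {A. A \<subseteq> Z \<and> card A = r}"
    using uniform by (auto simp: unsupported_def)
  ultimately show ?thesis
    using card_le_of_containing[OF finite_ground fin(4) _ _ cQ] by blast
qed

section \<open>Kernel pairs and their books\<close>

definition kernel_pairs :: "'a set set" where
  "kernel_pairs = {p. card p = 2 \<and> kernel p}"

definition pages :: "'a set \<Rightarrow> 'a set" where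
  "pages p = {c. c \<notin> p \<and> kernel (insert c p)}"

lemma kernel_pairD: "p \<in> kernel_pairs \<Longrightarrow> card p = 2" "p \<in> kernel_pairs \<Longrightarrow> kernel p"
  "p \<in> kernel_pairs \<Longrightarrow> finite p" "p \<in> kernel_pairs \<Longrightarrow> p \<subseteq> Z"
  using finite_kernel kernel_subset by (auto simp: kernel_pairs_def)

lemma finite_kernel_pairs: "finite kernel_pairs"
  by (rule finite_subset[of _ "Pow Z"]) (use kernel_pairD(4) finite_ground in auto)

lemma pages_subset: "pages p \<subseteq> Z"
  using kernel_subset by (auto simp: pages_def)

lemma finite_pages: "finite (pages p)"
  using finite_subset[OF pages_subset finite_ground] .

text \<open>Distinct pairs that intersect share exactly one point, which \<open>kernel_inter\<close>
  forbids.\<close>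

lemma kernel_pairs_disjoint:
  assumes "p \<in> kernel_pairs" "q \<in> kernel_pairs" "p \<noteq> q"
  shows "p \<inter> q = {}"
proof -
  have "card (p \<inter> q) \<noteq> 1"
    using assms r_ge_4 by (intro kernel_inter) (auto simp: kernel_pairs_def)
  moreover have "card (p \<inter> q) \<noteq> 2"
    using assms kernel_pairD card_subset_eq[of p "p \<inter> q"] card_subset_eq[of q "p \<inter> q"] by auto
  moreover have "card (p \<inter> q) \<le> 2"
    using kernel_pairD[OF assms(1)] card_mono[of p "p \<inter> q"] by auto
  ultimately have "card (p \<inter> q) = 0"
    by linarith
  then show ?thesis
    using kernel_pairD(3)[OF assms(1)] by simp
qed

text \<open>A point \<open>c\<close> common to two books would be the whole intersection of two
  kernels with at most three points each. That triples have fewer than \<open>r\<close> points uses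
  \<open>4 \<le> r\<close>.\<close>

lemma books_disjoint:
  assumes "p \<in> kernel_pairs" "q \<in> kernel_pairs" "p \<noteq> q"
  shows "(p \<union> pages p) \<inter> (q \<union> pages q) = {}"
proof -
  have pq: "p \<inter> q = {}"
    using kernel_pairs_disjoint[OF assms] .
  have c3: "card (insert c p) < r" if "p \<in> kernel_pairs" for c p
    using kernel_pairD(1,3)[OF that] r_ge_4 by (simp add: card_insert_if)
  have 1: "c \<notin> q" if "c \<in> pages p" "p \<in> kernel_pairs" "q \<in> kernel_pairs" "p \<inter> q = {}" for c p q
  proof
    assume "c \<in> q"
    then have "insert c p \<inter> q = {c}"
      using that by auto
    moreover have "card (insert c p \<inter> q) \<noteq> 1"
      using that c3 kernel_pairD r_ge_4 by (intro kernel_inter) (auto simp: pages_def)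
    ultimately show False by (metis is_singletonI is_singleton_altdef)
  qed
  have 2: "c \<notin> pages q" if "c \<in> pages p" for c
  proof
    assume "c \<in> pages q"
    then have "insert c p \<inter> insert c q = {c}"
      using that pq by (auto simp: pages_def)
    moreover have "card (insert c p \<inter> insert c q) \<noteq> 1"
      using that \<open>c \<in> pages q\<close> c3 assms by (intro kernel_inter) (auto simp: pages_def)
    ultimately show False by (metis is_singletonI is_singleton_altdef)
  qed
  show ?thesis
    using 1[of _ p q] 1[of _ q p] 2 pq assms by blast
qed

lemma card_books: "2 * card kernel_pairs + (\<Sum>p\<in>kernel_pairs. card (pages p)) \<le> card Z"
proof -
  have "2 * card kernel_pairs + (\<Sum>p\<in>kernel_pairs. card (pages p))
      = (\<Sum>p\<in>kernel_pairs. card p + card (pages p))"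
    by (simp only: sum.distrib) (simp add: kernel_pairD(1))
  also have "\<dots> = (\<Sum>p\<in>kernel_pairs. card (p \<union> pages p))"
    using kernel_pairD(3) finite_pages
    by (intro sum.cong card_Un_disjoint[symmetric]) (auto simp: pages_def)
  also have "\<dots> = card (\<Union>p\<in>kernel_pairs. p \<union> pages p)"
    using finite_kernel_pairs kernel_pairD(3) finite_pages books_disjoint
    by (intro card_UN_disjoint[symmetric]) auto
  also have "\<dots> \<le> card Z"
    using kernel_pairD(4) pages_subset by (intro card_mono[OF finite_ground] UN_least Un_least)
  finally show ?thesis .
qed

lemma card_kernel_pairs: "card kernel_pairs \<le> card Z"
  using card_books by linarith

section \<open>Kernel triples that contain no kernel pair\<close>

definition lone_triples :: "'a set set" where
  "lone_triples = {T. card T = 3 \<and> kernel T \<and> (\<forall>p\<in>kernel_pairs. \<not> p \<subseteq> T)}"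

lemma lone_tripleD: "T \<in> lone_triples \<Longrightarrow> card T = 3" "T \<in> lone_triples \<Longrightarrow> kernel T"
  "T \<in> lone_triples \<Longrightarrow> finite T" "T \<in> lone_triples \<Longrightarrow> T \<subseteq> Z"
  using finite_kernel kernel_subset by (auto simp: lone_triples_def)

lemma finite_lone_triples: "finite lone_triples"
  by (rule finite_subset[of _ "Pow Z"]) (use lone_tripleD(4) finite_ground in auto)

text \<open>If such a triple exists, then \<open>{a, b}\<close> is not a kernel, so the third point
  lies in \<open>cover {a, b}\<close>.\<close>

lemma card_lone_triples_pair:
  assumes "a \<noteq> b"
  shows "card {T \<in> lone_triples. {a, b} \<subseteq> T} \<le> M"
proof -
  have "{T \<in> lone_triples. {a, b} \<subseteq> T} \<subseteq> (\<lambda>c. insert c {a, b}) ` cover {a, b}"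
  proof
    fix T assume "T \<in> {T \<in> lone_triples. {a, b} \<subseteq> T}"
    then have T: "T \<in> lone_triples" "{a, b} \<subseteq> T" by auto
    have "card (T - {a, b}) = 1"
      using T lone_tripleD assms by (simp add: card_Diff_subset)
    then obtain c where "T - {a, b} = {c}"
      by (auto simp: card_1_singleton_iff)
    then have c: "T = insert c {a, b}"
      using T by blast
    have "{a, b} \<notin> kernel_pairs"
      using T by (auto simp: lone_triples_def)
    then have "\<not> kernel {a, b}"
      using assms by (simp add: kernel_pairs_def)
    then have "c \<in> cover {a, b}"
      using kernel_insert_in_cover lone_tripleD(2)[OF T(1)] c by blast
    then show "T \<in> (\<lambda>c. insert c {a, b}) ` cover {a, b}"
      using c by blast
  qed
  then show ?thesis
    by (rule order_trans[OF surj_card_le[OF finite_cover] card_cover])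
qed

text \<open>Fix one lone triple \<open>T\<close> through \<open>x\<close>. Any lone triple through
  \<open>x\<close> shares a second point with \<open>T\<close>, so it contains one of two
  pairs.\<close>

lemma card_lone_triples_point: "card {T \<in> lone_triples. x \<in> T} \<le> 2 * M"
proof (cases "\<exists>T\<in>lone_triples. x \<in> T")
  case True
  then obtain T where T: "T \<in> lone_triples" "x \<in> T" by blast
  have "card (T - {x}) = 2"
    using T lone_tripleD by simp
  then obtain a b where ab: "T - {x} = {a, b}" "a \<noteq> b"
    by (auto simp: card_2_iff)
  have "{S \<in> lone_triples. x \<in> S} \<subseteq> {S \<in> lone_triples. {x, a} \<subseteq> S} \<union> {S \<in> lone_triples. {x, b} \<subseteq> S}"
  proof
    fix S assume "S \<in> {S \<in> lone_triples. x \<in> S}"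
    then have S: "S \<in> lone_triples" "x \<in> S" by auto
    have "card (T \<inter> S) \<noteq> 1"
      using S T lone_tripleD r_ge_4 by (intro kernel_inter) auto
    then have "T \<inter> S \<noteq> {x}" by (metis is_singletonI is_singleton_altdef)
    then obtain y where y: "y \<in> S" "y \<in> T - {x}"
      using S(2) T(2) by blast
    then have "y = a \<or> y = b"
      unfolding ab(1) by simp
    then show "S \<in> {S \<in> lone_triples. {x, a} \<subseteq> S} \<union> {S \<in> lone_triples. {x, b} \<subseteq> S}"
      using S y(1) by auto
  qed
  then have "card {S \<in> lone_triples. x \<in> S}
      \<le> card ({S \<in> lone_triples. {x, a} \<subseteq> S} \<union> {S \<in> lone_triples. {x, b} \<subseteq> S})"
    using finite_lone_triples by (intro card_mono) auto
  also have "\<dots> \<le> card {S \<in> lone_triples. {x, a} \<subseteq> S} + card {S \<in> lone_triples. {x, b} \<subseteq> S}"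
    by (rule card_Un_le)
  also have "\<dots> \<le> 2 * M"
    using card_lone_triples_pair[of x a] card_lone_triples_pair[of x b] ab by fastforce
  finally show ?thesis .
next
  case False
  then have "{T \<in> lone_triples. x \<in> T} = {}" by blast
  then show ?thesis by (metis card.empty le0)
qed

lemma card_lone_triples: "card lone_triples \<le> card Z * (2 * M)"
proof -
  have "lone_triples \<subseteq> (\<Union>x\<in>Z. {T \<in> lone_triples. x \<in> T})"
  proof
    fix T assume T: "T \<in> lone_triples"
    then have "T \<noteq> {}"
      using lone_tripleD(1) by fastforce
    then show "T \<in> (\<Union>x\<in>Z. {T \<in> lone_triples. x \<in> T})"
      using T lone_tripleD(4) by blast
  qed
  then have "card lone_triples \<le> card (\<Union>x\<in>Z. {T \<in> lone_triples. x \<in> T})"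
    using finite_ground finite_lone_triples by (intro card_mono) auto
  also have "\<dots> \<le> card Z * (2 * M)"
    using finite_ground card_lone_triples_point by (intro card_UN_le_mult)
  finally show ?thesis .
qed

section \<open>Rare configurations\<close>

definition containing :: "'a set set \<Rightarrow> nat \<Rightarrow> 'a set set" where
  "containing QQ k = {A \<in> F. \<exists>Q\<in>QQ. Q \<subseteq> A \<and> card Q = k}"

lemma containingI: "\<lbrakk>A \<in> F; Q \<in> QQ; card Q = k; Q \<subseteq> A\<rbrakk> \<Longrightarrow> A \<in> containing QQ k"
  by (auto simp: containing_def)

lemma card_containing:
  assumes "finite QQ" "card QQ \<le> K * card Z ^ j"
  shows "card (containing QQ (j + 3)) \<le> K * card Z ^ (r - 3)"
  using uniform
  by (intro card_le_of_containing[OF finite_ground assms(1) _ _ assms(2)])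
     (auto simp: containing_def)

definition meeting_triples :: "'a set set" where
  "meeting_triples = (\<Union>T\<in>lone_triples. \<Union>x\<in>T. (\<lambda>S. T \<union> S) ` {S \<in> lone_triples. x \<in> S})"

definition two_triples :: "'a set set" where
  "two_triples = (\<lambda>(T, S). T \<union> S) ` (lone_triples \<times> lone_triples)"

definition triple_and_pair :: "'a set set" where
  "triple_and_pair = (\<lambda>(T, p). T \<union> p) ` (lone_triples \<times> kernel_pairs)"

definition page_and_pair :: "'a set set" where
  "page_and_pair = (\<lambda>((p, x), q). insert x (p \<union> q)) ` ((SIGMA p:kernel_pairs. pages p) \<times> kernel_pairs)"

definition three_pairs :: "'a set set" where
  "three_pairs = (\<lambda>(p, q, s). p \<union> q \<union> s) ` (kernel_pairs \<times> kernel_pairs \<times> kernel_pairs)"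

text \<open>Every configuration has at least three points more than its degrees of freedom: two
  intersecting lone triples have 4 points and linearly many choices, two disjoint ones 6 points and
  quadratically many, a triple or a page-and-spine with a further pair 5 points and quadratically
  many, and three pairs 6 points and cubically many.\<close>

definition exceptional :: "'a set set" where
  "exceptional = unsupported \<union> containing meeting_triples 4 \<union> containing two_triples 6
     \<union> containing triple_and_pair 5 \<union> containing page_and_pair 5 \<union> containing three_pairs 6"

lemma card_meeting_triples: "card (containing meeting_triples 4) \<le> (12 * M ^ 2) * card Z ^ (r - 3)"
proof -
  have fin: "finite meeting_triples"
    using finite_lone_triples lone_tripleD(3) by (auto simp: meeting_triples_def)
  have "card meeting_triples \<le> card lone_triples * (3 * (2 * M))"
    unfolding meeting_triples_def
  proof (rule card_UN_le_mult[OF finite_lone_triples])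
    fix T assume T: "T \<in> lone_triples"
    have "card (\<Union>x\<in>T. (\<lambda>S. T \<union> S) ` {S \<in> lone_triples. x \<in> S}) \<le> card T * (2 * M)"
      using lone_tripleD(3)[OF T] finite_lone_triples
      by (intro card_UN_le_mult order_trans[OF card_image_le card_lone_triples_point]) auto
    then show "card (\<Union>x\<in>T. (\<lambda>S. T \<union> S) ` {S \<in> lone_triples. x \<in> S}) \<le> 3 * (2 * M)"
      using lone_tripleD(1)[OF T] by simp
  qed
  also have "\<dots> \<le> (card Z * (2 * M)) * (3 * (2 * M))"
    by (intro mult_right_mono card_lone_triples) simp
  also have "\<dots> = (12 * M ^ 2) * card Z ^ 1"
    by (simp add: power2_eq_square)
  finally show ?thesis
    using card_containing[OF fin, of "12 * M ^ 2" 1] by simp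
qed

lemma card_two_triples: "card (containing two_triples 6) \<le> (4 * M ^ 2) * card Z ^ (r - 3)"
proof -
  have fin: "finite two_triples"
    using finite_lone_triples by (auto simp: two_triples_def)
  have "card two_triples \<le> card lone_triples * card lone_triples"
    unfolding two_triples_def using finite_lone_triples
    by (metis card_cartesian_product card_image_le finite_cartesian_product)
  also have "\<dots> \<le> (card Z * (2 * M)) * (card Z * (2 * M))"
    by (intro mult_mono card_lone_triples) auto
  also have "\<dots> = (4 * M ^ 2) * card Z ^ 2"
    by (simp add: power2_eq_square)
  \<comment> \<open>A quadratic number is more than enough: six points would allow a cubic
    one.\<close>
  also have "\<dots> \<le> (4 * M ^ 2) * card Z ^ 3"
    by (intro mult_left_mono) (auto simp: power2_eq_square power3_eq_cube)
  finally show ?thesis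
    using card_containing[OF fin, of "4 * M ^ 2" 3] by simp
qed

lemma card_triple_and_pair: "card (containing triple_and_pair 5) \<le> (2 * M) * card Z ^ (r - 3)"
proof -
  have fin: "finite triple_and_pair"
    using finite_lone_triples finite_kernel_pairs by (auto simp: triple_and_pair_def)
  have "card triple_and_pair \<le> card lone_triples * card kernel_pairs"
    unfolding triple_and_pair_def using finite_lone_triples finite_kernel_pairs
    by (metis card_cartesian_product card_image_le finite_cartesian_product)
  also have "\<dots> \<le> (card Z * (2 * M)) * card Z"
    by (intro mult_mono card_lone_triples card_kernel_pairs) auto
  also have "\<dots> = (2 * M) * card Z ^ 2"
    by (simp add: power2_eq_square)
  finally show ?thesis
    using card_containing[OF fin, of "2 * M" 2] by simp
qed

lemma card_page_and_pair: "card (containing page_and_pair 5) \<le> 1 * card Z ^ (r - 3)"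
proof -
  let ?S = "SIGMA p:kernel_pairs. pages p"
  have finS: "finite ?S"
    using finite_kernel_pairs finite_pages by auto
  then have fin: "finite page_and_pair"
    using finite_kernel_pairs by (auto simp: page_and_pair_def)
  have "card page_and_pair \<le> card ?S * card kernel_pairs"
    unfolding page_and_pair_def using finS finite_kernel_pairs
    by (metis card_cartesian_product card_image_le finite_cartesian_product)
  also have "card ?S = (\<Sum>p\<in>kernel_pairs. card (pages p))"
    using finite_kernel_pairs finite_pages by (intro card_SigmaI) auto
  also have "(\<Sum>p\<in>kernel_pairs. card (pages p)) * card kernel_pairs \<le> card Z * card Z"
    using card_books by (intro mult_mono card_kernel_pairs) auto
  also have "\<dots> = 1 * card Z ^ 2"
    by (simp add: power2_eq_square)
  finally show ?thesis
    using card_containing[OF fin, of 1 2] by simp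
qed

lemma card_three_pairs: "card (containing three_pairs 6) \<le> 1 * card Z ^ (r - 3)"
proof -
  have fin: "finite three_pairs"
    using finite_kernel_pairs by (auto simp: three_pairs_def)
  have "card three_pairs \<le> card (kernel_pairs \<times> kernel_pairs \<times> kernel_pairs)"
    unfolding three_pairs_def using finite_kernel_pairs
    by (intro card_image_le) auto
  also have "\<dots> = card kernel_pairs ^ 3"
    by (simp add: card_cartesian_product power3_eq_cube)
  also have "\<dots> \<le> 1 * card Z ^ 3"
    using card_kernel_pairs by (simp add: power_mono)
  finally show ?thesis
    using card_containing[OF fin, of 1 3] by simp
qed

lemma card_exceptional: "card exceptional \<le> 6 * M ^ 3 * card Z ^ (r - 3)"
proof -
  let ?z = "card Z ^ (r - 3)"
  have "card exceptional \<le> M ^ 3 * ?z + (12 * M ^ 2) * ?z + (4 * M ^ 2) * ?z + (2 * M) * ?z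
      + 1 * ?z + 1 * ?z"
    unfolding exceptional_def
    by (intro order_trans[OF card_Un_le] add_mono card_unsupported card_meeting_triples
        card_two_triples card_triple_and_pair card_page_and_pair card_three_pairs)
  also have "\<dots> = (M ^ 3 + 16 * M ^ 2 + 2 * M + 2) * ?z"
    by (simp add: algebra_simps)
  \<comment> \<open>By \<open>4 \<le> M\<close>, the term \<open>16 * M ^ 2\<close> is at most
    \<open>4 * M ^ 3\<close>, and \<open>2 * M + 2\<close> is at most \<open>M ^ 3\<close>.\<close>
  also have "\<dots> \<le> (6 * M ^ 3) * ?z"
  proof (intro mult_right_mono)
    have "4 * M ^ 2 \<le> M * M ^ 2"
      using M_ge by (intro mult_right_mono) auto
    moreover have "4 * M \<le> M * M"
      using M_ge by (intro mult_right_mono) auto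
    moreover have "M * M ^ 2 = M ^ 3" "M * M = M ^ 2"
      by (simp_all add: power2_eq_square power3_eq_cube)
    ultimately show "M ^ 3 + 16 * M ^ 2 + 2 * M + 2 \<le> 6 * M ^ 3"
      using M_ge by linarith
  qed simp
  finally show ?thesis .
qed

section \<open>Structure of the remaining members\<close>

lemma supported:
  assumes "A \<in> F - exceptional" "x \<in> A"
  obtains T where "x \<in> T" "T \<subseteq> A" "card T = 2 \<or> card T = 3" "kernel T"
  using assms unfolding exceptional_def unsupported_def by blast

text \<open>Take a point of \<open>A\<close> outside \<open>T\<close> and a kernel \<open>S\<close>
  supporting it. If \<open>S\<close> contains a kernel pair, this pair is disjoint from
  \<open>T\<close>; otherwise \<open>S\<close> is a lone triple sharing no or two points with
  \<open>T\<close>. Each case yields one of the rare configurations.\<close>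

lemma no_lone_triple:
  assumes A: "A \<in> F - exceptional" and T: "T \<in> lone_triples"
  shows "\<not> T \<subseteq> A"
proof
  assume TA: "T \<subseteq> A"
  have AF: "A \<in> F" using A by blast
  have "card T < card A"
    using lone_tripleD(1)[OF T] member(2)[OF AF] r_ge_4 by simp
  then obtain x where x: "x \<in> A" "x \<notin> T"
    using TA by (metis less_irrefl subset_antisym subsetI)
  obtain S where S: "x \<in> S" "S \<subseteq> A" "card S = 2 \<or> card S = 3" "kernel S"
    using supported[OF A x(1)] by blast
  show False
  proof (cases "\<exists>p\<in>kernel_pairs. p \<subseteq> S")
    case True
    then obtain p where p: "p \<in> kernel_pairs" "p \<subseteq> S" by blast
    have "card (T \<inter> p) \<noteq> 1"
      using T p lone_tripleD kernel_pairD r_ge_4 by (intro kernel_inter) auto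
    moreover have "T \<inter> p \<subset> p"
      using p T unfolding lone_triples_def by blast
    then have "card (T \<inter> p) < 2"
      using kernel_pairD[OF p(1)] psubset_card_mono[of p "T \<inter> p"] by simp
    ultimately have "card (T \<inter> p) = 0" by linarith
    then have "card (T \<union> p) = 5"
      using lone_tripleD[OF T] kernel_pairD[OF p(1)] card_Un_Int[of T p] by simp
    moreover have "T \<union> p \<in> triple_and_pair"
      using T p by (auto simp: triple_and_pair_def)
    ultimately have "A \<in> containing triple_and_pair 5"
      using TA subset_trans[OF p(2) S(2)] by (intro containingI[OF AF, of "T \<union> p"]) auto
    then show False
      using A by (simp add: exceptional_def)
  next
    case False
    then have "card S = 3"
      using S by (auto simp: kernel_pairs_def)
    then have SL: "S \<in> lone_triples"
      using False S by (simp add: lone_triples_def)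
    have "card (T \<inter> S) \<noteq> 1"
      using T SL lone_tripleD r_ge_4 by (intro kernel_inter) auto
    moreover have "card (T \<inter> S) < card S"
      using x S lone_tripleD(3)[OF SL] by (intro psubset_card_mono) auto
    ultimately consider "card (T \<inter> S) = 0" | "card (T \<inter> S) = 2"
      using \<open>card S = 3\<close> by linarith
    then show False
    proof cases
      case 1
      then have "card (T \<union> S) = 6"
        using lone_tripleD[OF T] lone_tripleD[OF SL] card_Un_Int[of T S] by simp
      moreover have "T \<union> S \<in> two_triples"
        using T SL by (auto simp: two_triples_def)
      ultimately have "A \<in> containing two_triples 6"
        using TA S(2) by (intro containingI[OF AF, of "T \<union> S"]) auto
      then show False
        using A by (simp add: exceptional_def)
    next
      case 2
      then have "card (T \<union> S) = 4"
        using lone_tripleD[OF T] lone_tripleD[OF SL] card_Un_Int[of T S] by simp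
      moreover obtain y where "y \<in> T" "y \<in> S"
        using 2 by (metis IntE card.empty ex_in_conv zero_neq_numeral)
      then have "T \<union> S \<in> meeting_triples"
        using T SL unfolding meeting_triples_def by blast
      ultimately have "A \<in> containing meeting_triples 4"
        using TA S(2) by (intro containingI[OF AF, of "T \<union> S"]) auto
      then show False
        using A by (simp add: exceptional_def)
    qed
  qed
qed

text \<open>The kernel supporting \<open>x\<close> is a pair, or a triple that is not lone and so
  arises from a kernel pair by adding one page.\<close>

lemma in_book:
  assumes A: "A \<in> F - exceptional" and x: "x \<in> A"
  obtains p where "p \<in> kernel_pairs" "p \<subseteq> A" "x \<in> p \<union> pages p"
proof -
  obtain T where T: "x \<in> T" "T \<subseteq> A" "card T = 2 \<or> card T = 3" "kernel T"
    using supported[OF A x] by blast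
  show ?thesis
  proof (cases "card T = 2")
    case True
    then show ?thesis
      using T by (intro that[of T]) (auto simp: kernel_pairs_def)
  next
    case False
    then have 3: "card T = 3" using T by blast
    then have "T \<notin> lone_triples"
      using no_lone_triple[OF A] T by blast
    then obtain p where p: "p \<in> kernel_pairs" "p \<subseteq> T"
      using 3 T by (auto simp: lone_triples_def)
    have "x \<in> pages p" if "x \<notin> p"
    proof -
      have "insert x p = T"
        using that p T 3 kernel_pairD[OF p(1)] finite_kernel[OF T(4)]
        by (intro card_subset_eq) auto
      then show ?thesis
        using that T by (simp add: pages_def)
    qed
    then show ?thesis
      using p T by (intro that[of p]) auto
  qed
qed

text \<open>If some point of \<open>A\<close> is outside the book of a pair \<open>p\<close> in
  \<open>A\<close>, then \<open>A\<close> contains a second pair. Then all of \<open>A\<close> is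
  covered by kernel pairs, and as three of them are excluded, \<open>A\<close> is the union of
  two.\<close>

lemma book_or_two_pairs:
  assumes A: "A \<in> F - exceptional"
  shows "(\<exists>p\<in>kernel_pairs. p \<subseteq> A \<and> A - p \<subseteq> pages p) \<or>
    r = 4 \<and> (\<exists>p\<in>kernel_pairs. \<exists>q\<in>kernel_pairs. A = p \<union> q)"
proof (rule disjCI)
  assume not2: "\<not> (r = 4 \<and> (\<exists>p\<in>kernel_pairs. \<exists>q\<in>kernel_pairs. A = p \<union> q))"
  have AF: "A \<in> F" using A by blast
  then have "A \<noteq> {}"
    using member(2)[OF AF] r_ge_4 by auto
  then obtain p where p: "p \<in> kernel_pairs" "p \<subseteq> A"
    using in_book[OF A] by blast
  have "A - p \<subseteq> pages p"
  proof (rule ccontr)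
    assume "\<not> A - p \<subseteq> pages p"
    then obtain y where y: "y \<in> A" "y \<notin> p \<union> pages p" by blast
    then obtain q where q: "q \<in> kernel_pairs" "q \<subseteq> A" "y \<in> q \<union> pages q"
      using in_book[OF A y(1)] by blast
    have pq: "p \<noteq> q" using y q by blast
    \<comment> \<open>A point that is only a page of some \<open>s\<close> would, together with
      \<open>s\<close> and another kernel pair \<open>t\<close> in \<open>A\<close>, form a set of
      \<open>page_and_pair\<close> with five points.\<close>
    have in_pair: "\<exists>s\<in>kernel_pairs. s \<subseteq> A \<and> x \<in> s" if x: "x \<in> A" for x
    proof (rule ccontr)
      assume no: "\<not> (\<exists>s\<in>kernel_pairs. s \<subseteq> A \<and> x \<in> s)"
      obtain s where s: "s \<in> kernel_pairs" "s \<subseteq> A" "x \<in> s \<union> pages s"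
        using in_book[OF A x] by blast
      obtain t where t: "t \<in> kernel_pairs" "t \<subseteq> A" "t \<noteq> s"
        using p q pq by metis
      have "x \<notin> s \<union> t"
        using no s t by blast
      then have "card (insert x (s \<union> t)) = 5"
        using kernel_pairD(1,3)[OF s(1)] kernel_pairD(1,3)[OF t(1)]
          kernel_pairs_disjoint[OF s(1) t(1)] t(3) by (simp add: card_Un_disjoint)
      moreover have "insert x (s \<union> t) \<in> page_and_pair"
        unfolding page_and_pair_def
        using s t no by (intro image_eqI[of _ _ "((s, x), t)"]) auto
      moreover have "insert x (s \<union> t) \<subseteq> A"
        using s t x by blast
      ultimately have "A \<in> containing page_and_pair 5"
        by (intro containingI[OF AF])
      then show False
        using A by (simp add: exceptional_def)
    qed
    have disj: "p \<inter> q = {}"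
      using kernel_pairs_disjoint p q pq by blast
    have 4: "card (p \<union> q) = 4"
      using disj kernel_pairD(1,3)[OF p(1)] kernel_pairD(1,3)[OF q(1)] by (simp add: card_Un_disjoint)
    have "A \<noteq> p \<union> q"
      using not2 p q 4 member(2)[OF AF] by metis
    then obtain x where x: "x \<in> A" "x \<notin> p \<union> q"
      using p q by blast
    then obtain s where s: "s \<in> kernel_pairs" "s \<subseteq> A" "x \<in> s"
      using in_pair by blast
    have "s \<inter> (p \<union> q) = {}"
      using kernel_pairs_disjoint[OF s(1) p(1)] kernel_pairs_disjoint[OF s(1) q(1)] x s by blast
    then have "card (p \<union> q \<union> s) = 6"
      using 4 kernel_pairD[OF p(1)] kernel_pairD[OF q(1)] kernel_pairD[OF s(1)]
      by (subst card_Un_disjoint) auto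
    moreover have "p \<union> q \<union> s \<in> three_pairs"
      unfolding three_pairs_def using p q s by (intro image_eqI[of _ _ "(p, q, s)"]) auto
    moreover have "p \<union> q \<union> s \<subseteq> A"
      using p q s by blast
    ultimately have "A \<in> containing three_pairs 6"
      by (intro containingI[OF AF])
    then show False
      using A by (simp add: exceptional_def)
  qed
  then show "\<exists>p\<in>kernel_pairs. p \<subseteq> A \<and> A - p \<subseteq> pages p"
    using p by blast
qed

text \<open>Used with all kernel pairs and with all but the one having most pages.\<close>

lemma card_le_books:
  assumes "PP \<subseteq> kernel_pairs" "G \<subseteq> F"
    and G: "\<And>A p. \<lbrakk>A \<in> G; p \<in> kernel_pairs; p \<subseteq> A; A - p \<subseteq> pages p\<rbrakk> \<Longrightarrow> p \<in> PP"
  shows "card G \<le> 6 * M ^ 3 * card Z ^ (r - 3) + (if r = 4 then card kernel_pairs ^ 2 else 0)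
    + (\<Sum>p\<in>PP. card (pages p) choose (r - 2))"
proof -
  have finPP: "finite PP"
    using assms(1) finite_kernel_pairs by (rule finite_subset)
  let ?two = "if r = 4 then (\<lambda>(p, q). p \<union> q) ` (kernel_pairs \<times> kernel_pairs) else {}"
  let ?star = "\<lambda>p. (\<lambda>R. p \<union> R) ` {R. R \<subseteq> pages p \<and> card R = r - 2}"
  have "G \<subseteq> exceptional \<union> ?two \<union> (\<Union>p\<in>PP. ?star p)"
  proof
    fix A assume A: "A \<in> G"
    show "A \<in> exceptional \<union> ?two \<union> (\<Union>p\<in>PP. ?star p)"
    proof (cases "A \<in> exceptional")
      case False
      then have AF: "A \<in> F - exceptional"
        using A assms(2) by blast
      from book_or_two_pairs[OF this] show ?thesis
      proof
        assume "\<exists>p\<in>kernel_pairs. p \<subseteq> A \<and> A - p \<subseteq> pages p"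
        then obtain p where p: "p \<in> kernel_pairs" "p \<subseteq> A" "A - p \<subseteq> pages p" by blast
        have "card (A - p) = r - 2"
          using p AF kernel_pairD[OF p(1)] member(2) by (simp add: card_Diff_subset)
        then have "A - p \<in> {R. R \<subseteq> pages p \<and> card R = r - 2}"
          using p by simp
        moreover have "A = p \<union> (A - p)"
          using p by blast
        ultimately have "A \<in> ?star p"
          by (rule rev_image_eqI)
        then show ?thesis
          using G[OF A p] by blast
      next
        assume "r = 4 \<and> (\<exists>p\<in>kernel_pairs. \<exists>q\<in>kernel_pairs. A = p \<union> q)"
        then have "A \<in> ?two" by auto
        then show ?thesis by blast
      qed
    qed simp
  qed
  moreover have "exceptional \<subseteq> F"
    by (auto simp: exceptional_def unsupported_def containing_def)
  then have "finite exceptional"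
    using finite_family by (rule finite_subset)
  ultimately have "card G \<le> card (exceptional \<union> ?two \<union> (\<Union>p\<in>PP. ?star p))"
    using finPP finite_pages finite_kernel_pairs by (intro card_mono) auto
  also have "\<dots> \<le> card exceptional + card ?two + card (\<Union>p\<in>PP. ?star p)"
    by (intro order_trans[OF card_Un_le] add_mono card_Un_le order_refl)
  also have "\<dots> \<le> 6 * M ^ 3 * card Z ^ (r - 3) + (if r = 4 then card kernel_pairs ^ 2 else 0)
    + (\<Sum>p\<in>PP. card (pages p) choose (r - 2))"
  proof (intro add_mono card_exceptional)
    have "card ((\<lambda>(p, q). p \<union> q) ` (kernel_pairs \<times> kernel_pairs)) \<le> card (kernel_pairs \<times> kernel_pairs)"
      using finite_kernel_pairs by (intro card_image_le) auto
    then show "card ?two \<le> (if r = 4 then card kernel_pairs ^ 2 else 0)"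
      by (cases "r = 4") (simp_all only: simp_thms if_True if_False card_cartesian_product power2_eq_square card.empty le0)
    have "card (\<Union>p\<in>PP. ?star p) \<le> (\<Sum>p\<in>PP. card (?star p))"
      using finPP by (rule card_UN_le)
    also have "\<dots> \<le> (\<Sum>p\<in>PP. card (pages p) choose (r - 2))"
    proof (rule sum_mono)
      fix p
      have "card (?star p) \<le> card {R. R \<subseteq> pages p \<and> card R = r - 2}"
        using finite_pages by (intro card_image_le) auto
      then show "card (?star p) \<le> card (pages p) choose (r - 2)"
        using finite_pages by (simp add: n_subsets)
    qed
    finally show "card (\<Union>p\<in>PP. ?star p) \<le> (\<Sum>p\<in>PP. card (pages p) choose (r - 2))" .
  qed
  finally show ?thesis .
qed

text \<open>All but one of the \<open>r - 2\<close> factors for a book are bounded by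
  \<open>card Z\<close>, and the page numbers add up to at most \<open>card Z\<close>. This crude
  bound suffices when the ground set is small.\<close>

lemma card_family_le: "card F \<le> 6 * M ^ 3 * card Z ^ (r - 3) + 2 * card Z ^ (r - 2)"
proof -
  have Suc: "Suc (r - 3) = r - 2"
    using r_ge_4 by simp
  have "card F \<le> 6 * M ^ 3 * card Z ^ (r - 3) + (if r = 4 then card kernel_pairs ^ 2 else 0)
    + (\<Sum>p\<in>kernel_pairs. card (pages p) choose (r - 2))"
    by (rule card_le_books) auto
  also have "(if r = 4 then card kernel_pairs ^ 2 else 0) \<le> card Z ^ (r - 2)"
    using card_kernel_pairs by (auto simp: power_mono)
  also have "(\<Sum>p\<in>kernel_pairs. card (pages p) choose (r - 2)) \<le> (\<Sum>p\<in>kernel_pairs. card (pages p) ^ Suc (r - 3))"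
    unfolding Suc by (intro sum_mono choose_le_power)
  also have "\<dots> \<le> card Z ^ (r - 3) * (\<Sum>p\<in>kernel_pairs. card (pages p))"
    using pages_subset finite_ground by (intro sum_power_Suc_le card_mono) auto
  also have "\<dots> \<le> card Z ^ (r - 3) * card Z"
    using card_books by (intro mult_left_mono) auto
  also have "\<dots> = card Z ^ Suc (r - 3)"
    by simp
  finally show ?thesis
    unfolding Suc by (simp add: algebra_simps)
qed

end

subsection \<open>Families close to the extremal size\<close>

lemma power_le_choose_fact: "(N - s) ^ s \<le> (N choose s) * fact s" for N s :: nat
proof (induction s)
  case (Suc s)
  have "(N - Suc s) ^ Suc s \<le> (N - s) * (N - s) ^ s"
    unfolding power_Suc by (intro mult_mono power_mono) auto
  also have "\<dots> \<le> (N - s) * ((N choose s) * fact s)"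
    using Suc.IH by (intro mult_left_mono) auto
  also have "\<dots> = (N - s) * (N choose s) * fact s"
    by simp
  also have "(N - s) * (N choose s) = Suc s * (N choose Suc s)"
    by (simp only: binomial_absorb_comp binomial_absorption)
  finally show ?case
    by (simp only: fact_Suc of_nat_id mult.commute mult.left_commute)
qed simp

text \<open>The right-hand side is at least \<open>(n - a - s) ^ s\<close>, whose ratio to
  \<open>n ^ s\<close> tends to 1.\<close>

lemma eventually_choose_ge:
  fixes \<eta> :: real and a s :: nat
  assumes "0 < \<eta>"
  shows "eventually (\<lambda>n. (1 - \<eta>) * real n ^ s \<le> real ((n - a) choose s) * fact s) sequentially"
proof -
  have "(\<lambda>n. (1 - (real (a + s)) / real n) ^ s) \<longlonglongrightarrow> (1 - 0) ^ s"
    by (intro tendsto_intros lim_const_over_n)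
  then have "eventually (\<lambda>n. 1 - \<eta> < (1 - (real (a + s)) / real n) ^ s) sequentially"
    using assms by (intro order_tendstoD(1)) auto
  then show ?thesis
    using eventually_ge_at_top[of "a + s + 1"]
  proof eventually_elim
    case (elim n)
    have "(1 - \<eta>) * real n ^ s \<le> (1 - (real (a + s)) / real n) ^ s * real n ^ s"
      using elim by (intro mult_right_mono) auto
    also have "\<dots> = ((1 - (real (a + s)) / real n) * real n) ^ s"
      by (simp add: power_mult_distrib)
    also have "(1 - (real (a + s)) / real n) * real n = real (n - a - s)"
      using elim by (simp add: field_simps of_nat_diff)
    also have "real (n - a - s) ^ s = real ((n - a - s) ^ s)"
      by simp
    also have "\<dots> \<le> real (((n - a) choose s) * fact s)"
      using power_le_choose_fact by (intro of_nat_mono)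
    finally show ?case by simp
  qed
qed

context sparse_family
begin

text \<open>With n points, q kernel pairs and c pages of the largest book, the size of the family forces
  the square of n to be at most about 2 q q + c (n - 2 q), so that q is small and c is close to n.\<close>

lemma most_contain_pair:
  fixes \<delta> :: real
  assumes \<delta>: "0 < \<delta>" "\<delta> < 1 / 3" and ne: "Z \<noteq> {}"
    and M: "6 * real M ^ 3 * fact (r - 2) \<le> \<delta> * real (card Z)"
    and large: "(1 - 2 * \<delta>) * real (card Z) ^ (r - 2) \<le> real (card F) * fact (r - 2)"
  shows "\<exists>p. p \<subseteq> Z \<and> card p = 2 \<and>
    real (card {A \<in> F. \<not> p \<subseteq> A}) * fact (r - 2) \<le> 40 * \<delta> * real (card Z) ^ (r - 2)"
proof -
  \<comment> \<open>With \<open>j\<close>, both \<open>r - 2\<close> and \<open>r - 3\<close> become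
    successors, so that single factors can be split off.\<close>
  define j where "j = r - 4"
  have j: "r - 2 = Suc (Suc j)" "r - 3 = Suc j"
    using r_ge_4 by (auto simp: j_def)
  define x where "x = real (card Z)"
  define q where "q = real (card kernel_pairs)"
  define c where "c p = real (card (pages p))" for p
  let ?s = "r - 2"
  have x: "x > 0"
    using ne finite_ground by (simp add: x_def card_gt_0_iff)
  have q0: "0 \<le> q" and c0: "\<And>p. 0 \<le> c p"
    by (auto simp: q_def c_def)
  have cx: "c p \<le> x" for p
    using card_mono[OF finite_ground pages_subset] by (simp add: c_def x_def)
  have books: "2 * q + (\<Sum>p\<in>kernel_pairs. c p) \<le> x"
    using card_books unfolding q_def c_def x_def of_nat_sum[symmetric] by linarith
  have x2: "x ^ ?s = x ^ j * x\<^sup>2"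
    by (simp add: j power2_eq_square)
  have bound: "real (card G) * fact ?s \<le> \<delta> * x ^ ?s + 2 * q\<^sup>2 * x ^ j + (\<Sum>p\<in>PP. c p ^ ?s)"
    if PP: "PP \<subseteq> kernel_pairs" and G: "G \<subseteq> F"
      "\<And>A p. \<lbrakk>A \<in> G; p \<in> kernel_pairs; p \<subseteq> A; A - p \<subseteq> pages p\<rbrakk> \<Longrightarrow> p \<in> PP" for PP G
  proof -
    have "real (card G) * fact ?s \<le> real (6 * M ^ 3 * card Z ^ (r - 3)
        + (if r = 4 then card kernel_pairs ^ 2 else 0) + (\<Sum>p\<in>PP. card (pages p) choose ?s)) * fact ?s"
      using card_le_books[OF PP G] by (intro mult_right_mono of_nat_mono) auto
    also have "\<dots> = 6 * real M ^ 3 * fact ?s * x ^ (r - 3)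
        + (if r = 4 then q\<^sup>2 else 0) * fact ?s + (\<Sum>p\<in>PP. real ((card (pages p) choose ?s) * fact ?s))"
      by (simp add: x_def q_def distrib_right sum_distrib_right)
    also have "\<dots> \<le> \<delta> * x ^ ?s + 2 * q\<^sup>2 * x ^ j + (\<Sum>p\<in>PP. c p ^ ?s)"
    proof (intro add_mono sum_mono)
      have "6 * real M ^ 3 * fact ?s * x ^ (r - 3) \<le> (\<delta> * x) * x ^ (r - 3)"
        using M x by (intro mult_right_mono) (auto simp: x_def)
      then show "6 * real M ^ 3 * fact ?s * x ^ (r - 3) \<le> \<delta> * x ^ ?s"
        by (simp add: j)
      \<comment> \<open>For \<open>r = 4\<close> the factorial is 2 and \<open>j = 0\<close>;
        otherwise the left side vanishes.\<close>
      show "(if r = 4 then q\<^sup>2 else 0) * fact ?s \<le> 2 * q\<^sup>2 * x ^ j"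
        using x by (cases "r = 4") (auto simp: j_def fact_2)
      show "real ((card (pages p) choose ?s) * fact ?s) \<le> c p ^ ?s" for p
        unfolding c_def of_nat_power[symmetric] by (intro of_nat_mono binomial_fact_pow)
    qed
    finally show ?thesis .
  qed
  have main: "(1 - 3 * \<delta>) * x ^ ?s \<le> 2 * q\<^sup>2 * x ^ j + (\<Sum>p\<in>kernel_pairs. c p ^ ?s)"
    using bound[of kernel_pairs F] large by (simp add: x_def algebra_simps)
  have "kernel_pairs \<noteq> {}"
  proof
    assume e: "kernel_pairs = {}"
    then have "q = 0" by (simp add: q_def)
    then have "(1 - 3 * \<delta>) * x ^ ?s \<le> 0"
      using main e by simp
    moreover have "(1 - 3 * \<delta>) * x ^ ?s > 0"
      using \<delta> x by (intro mult_pos_pos) auto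
    ultimately show False by simp
  qed
  then have "Max (c ` kernel_pairs) \<in> c ` kernel_pairs"
    using finite_kernel_pairs by (intro Max_in) auto
  then obtain p where p1: "p \<in> kernel_pairs" "Max (c ` kernel_pairs) = c p"
    by blast
  have p: "p \<in> kernel_pairs" "\<And>t. t \<in> kernel_pairs \<Longrightarrow> c t \<le> c p"
    using p1 finite_kernel_pairs Max_ge[of "c ` kernel_pairs"] by auto
  have sum_c: "(\<Sum>t\<in>PP. c t ^ ?s) \<le> b ^ Suc j * (\<Sum>t\<in>PP. c t)" if "\<And>t. t \<in> PP \<Longrightarrow> c t \<le> b" for PP b
    unfolding j using c0 that by (rule sum_power_Suc_le)
  have "(\<Sum>t\<in>kernel_pairs. c t ^ ?s) \<le> c p ^ Suc j * (\<Sum>t\<in>kernel_pairs. c t)"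
    using p(2) by (rule sum_c)
  \<comment> \<open>Only one factor \<open>c p\<close> is kept; replacing the others by
    \<open>x\<close> leaves an inequality that is quadratic after division by
    \<open>x ^ j\<close>.\<close>
  also have "\<dots> \<le> (x ^ j * c p) * (x - 2 * q)"
    unfolding power_Suc2 using c0 cx books x
    by (intro mult_mono mult_right_mono power_mono sum_nonneg mult_nonneg_nonneg) auto
  finally have "(1 - 3 * \<delta>) * x ^ ?s \<le> 2 * q\<^sup>2 * x ^ j + (x ^ j * c p) * (x - 2 * q)"
    using main by linarith
  then have "x ^ j * ((1 - 3 * \<delta>) * x\<^sup>2) \<le> x ^ j * (2 * q\<^sup>2 + c p * (x - 2 * q))"
    unfolding x2 by (simp add: algebra_simps)
  then have quad: "(1 - 3 * \<delta>) * x\<^sup>2 \<le> 2 * q\<^sup>2 + c p * (x - 2 * q)"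
    using x by (simp add: mult_le_cancel_left)
  have "0 \<le> (\<Sum>t\<in>kernel_pairs. c t)"
    by (intro sum_nonneg c0)
  then have q2: "2 * q \<le> x"
    using books by linarith
  \<comment> \<open>First \<open>c p\<close> is replaced by \<open>x\<close>, which shows that
    \<open>q\<close> is small; the bound on \<open>q\<close> is then put back to show that
    \<open>c p\<close> is close to \<open>x\<close>.\<close>
  have "c p * (x - 2 * q) \<le> x * (x - 2 * q)"
    using q2 cx by (intro mult_right_mono) auto
  moreover have "q * (2 * q) \<le> q * x"
    using q2 q0 by (intro mult_left_mono)
  ultimately have "q * x \<le> (3 * \<delta> * x) * x"
    using quad by (simp add: algebra_simps power2_eq_square)
  then have q3: "q \<le> 3 * \<delta> * x"
    using x by simp
  have "q\<^sup>2 \<le> (3 * \<delta> * x)\<^sup>2"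
    using q3 q0 by (intro power_mono)
  also have "\<dots> = 9 * \<delta> * (\<delta> * x\<^sup>2)"
    by (simp add: power2_eq_square)
  also have "\<dots> \<le> 9 * (1/3) * (\<delta> * x\<^sup>2)"
    using \<delta> x by (intro mult_right_mono) auto
  finally have q4: "2 * q\<^sup>2 \<le> 6 * \<delta> * x\<^sup>2" by simp
  have "c p * (x - 2 * q) \<le> c p * x"
    using c0 q0 by (intro mult_left_mono) auto
  then have "x * (x - c p) \<le> x * (9 * \<delta> * x)"
    using quad q4 by (simp add: algebra_simps power2_eq_square)
  then have cp: "x - c p \<le> 9 * \<delta> * x"
    using x by simp
  let ?PP = "kernel_pairs - {p}"
  let ?G = "{A \<in> F. \<not> p \<subseteq> A}"
  have "(\<Sum>t\<in>kernel_pairs. c t) = c p + (\<Sum>t\<in>?PP. c t)"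
    using finite_kernel_pairs p(1) by (rule sum.remove)
  then have "(\<Sum>t\<in>?PP. c t) \<le> 9 * \<delta> * x"
    using cp books q0 by linarith
  then have "x ^ Suc j * (\<Sum>t\<in>?PP. c t) \<le> x ^ Suc j * (9 * \<delta> * x)"
    using x by (intro mult_left_mono) auto
  moreover have "(\<Sum>t\<in>?PP. c t ^ ?s) \<le> x ^ Suc j * (\<Sum>t\<in>?PP. c t)"
    using cx by (rule sum_c)
  moreover have "2 * q\<^sup>2 * x ^ j \<le> 6 * \<delta> * x\<^sup>2 * x ^ j"
    using q4 x by (intro mult_right_mono) auto
  \<comment> \<open>A set not containing \<open>p\<close> cannot belong to the book of
    \<open>p\<close>, so the largest book drops out of the sum. The three terms are at most 1, 6 and
    9 times \<open>\<delta> * x ^ ?s\<close>.\<close>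
  moreover have "real (card ?G) * fact ?s \<le> \<delta> * x ^ ?s + 2 * q\<^sup>2 * x ^ j + (\<Sum>t\<in>?PP. c t ^ ?s)"
    by (rule bound) auto
  moreover have "x ^ Suc j * (9 * \<delta> * x) = 9 * \<delta> * x ^ ?s" "6 * \<delta> * x\<^sup>2 * x ^ j = 6 * \<delta> * x ^ ?s"
    by (simp_all add: x2 power2_eq_square)
  moreover have "0 \<le> \<delta> * x ^ ?s"
    using \<delta> x by simp
  ultimately have "real (card ?G) * fact ?s \<le> 40 * \<delta> * x ^ ?s"
    by linarith
  then show ?thesis
    using p(1) kernel_pairD unfolding x_def by blast
qed

end

section \<open>Stars and the edges inside a family\<close>

abbreviation vertices :: "nat \<Rightarrow> nat \<Rightarrow> nat set set" where
  "vertices n r \<equiv> {A. A \<subseteq> {1..n} \<and> card A = r}"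

definition star :: "nat \<Rightarrow> nat \<Rightarrow> nat set \<Rightarrow> nat set set" where
  "star n r p = {A \<in> vertices n r. p \<subseteq> A}"

definition inner_edges :: "'v graph \<Rightarrow> 'v set \<Rightarrow> 'v set set" where
  "inner_edges G F = {e \<in> snd G. e \<subseteq> F}"

lemma finite_vertices: "finite (vertices n r)"
  by simp

lemma finite_edges: "finite (snd (intersection_graph n r s))"
  by (rule finite_subset[of _ "Pow (vertices n r)"]) (auto simp: intersection_graph_def Let_def)

lemma star_subset: "star n r p \<subseteq> vertices n r"
  by (auto simp: star_def)

lemma edgeI:
  assumes "A \<in> vertices n r" "B \<in> vertices n r" "A \<noteq> B" "card (A \<inter> B) = s"
  shows "{A, B} \<in> snd (intersection_graph n r s)"
  using assms unfolding intersection_graph_def Let_def by auto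

lemma card_star:
  assumes "p \<subseteq> {1..n}" "card p = 2" "2 \<le> r"
  shows "card (star n r p) = (n - 2) choose (r - 2)"
proof -
  have "star n r p = {A. A \<subseteq> {1..n} \<and> card A = r \<and> A \<inter> p = p}"
    by (auto simp: star_def)
  then show ?thesis
    using card_subsets_with_trace[of "{1..n}" p p r] assms by simp
qed

text \<open>Double counting of ordered adjacent pairs, of which each edge provides at most
  two.\<close>

lemma card_high_degree:
  assumes F: "F \<subseteq> vertices n r" and "2 \<le> r"
  shows "card {A \<in> F. L < card {B \<in> F. card (A \<inter> B) = 1}} * L
    \<le> 2 * card (inner_edges (intersection_graph n r 1) F)"
proof -
  let ?N = "\<lambda>A. {B \<in> F. card (A \<inter> B) = 1}"
  let ?H = "{A \<in> F. L < card (?N A)}"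
  let ?E = "inner_edges (intersection_graph n r 1) F"
  have finF: "finite F"
    using F finite_vertices by (rule finite_subset)
  have finE: "finite ?E"
    using finite_edges by (auto simp: inner_edges_def)
  have "card ?H * L = (\<Sum>A\<in>?H. L)"
    by simp
  also have "\<dots> \<le> (\<Sum>A\<in>?H. card (?N A))"
    by (intro sum_mono) auto
  also have "\<dots> \<le> (\<Sum>A\<in>F. card (?N A))"
    using finF by (intro sum_mono2) auto
  also have "\<dots> = card (SIGMA A:F. ?N A)"
    using finF by simp
  also have "\<dots> \<le> card (\<Union>e\<in>?E. {(A, B). {A, B} = e \<and> A \<in> F \<and> B \<in> F})"
  proof (intro card_mono subsetI)
    show "finite (\<Union>e\<in>?E. {(A, B). {A, B} = e \<and> A \<in> F \<and> B \<in> F})"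
      by (rule finite_subset[of _ "F \<times> F"]) (use finF in auto)
    fix AB assume "AB \<in> (SIGMA A:F. ?N A)"
    then obtain A B where AB: "AB = (A, B)" "A \<in> F" "B \<in> F" "card (A \<inter> B) = 1"
      by auto
    moreover have "A \<noteq> B"
      using AB F assms(2) by auto
    ultimately have "{A, B} \<in> snd (intersection_graph n r 1)"
      using F by (intro edgeI) auto
    then have "{A, B} \<in> ?E"
      using AB by (simp add: inner_edges_def)
    then show "AB \<in> (\<Union>e\<in>?E. {(A, B). {A, B} = e \<and> A \<in> F \<and> B \<in> F})"
      using AB by auto
  qed
  also have "\<dots> \<le> card ?E * 2"
  proof (rule card_UN_le_mult[OF finE])
    fix e assume "e \<in> ?E"
    then obtain A B where e: "e = {A, B}"
      by (auto simp: inner_edges_def intersection_graph_def Let_def)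
    have "{(C, D). {C, D} = e \<and> C \<in> F \<and> D \<in> F} \<subseteq> {(A, B), (B, A)}"
      unfolding e by (auto simp: doubleton_eq_iff)
    then have "card {(C, D). {C, D} = e \<and> C \<in> F \<and> D \<in> F} \<le> card {(A, B), (B, A)}"
      by (intro card_mono) auto
    also have "\<dots> \<le> 2"
      by (cases "A = B") auto
    finally show "card {(C, D). {C, D} = e \<and> C \<in> F \<and> D \<in> F} \<le> 2" .
  qed
  finally show ?thesis by simp
qed

subsection \<open>Members outside the star\<close>

text \<open>With few edges, most outside members have small degree. The star members missing because
  of them bound \<open>k\<close> below by \<open>c * card Z * n ^ (r - 3)\<close>, where
  \<open>Z\<close> is the set of points they cover, while the structure on \<open>Z\<close> makes
  \<open>k\<close> smaller than this.\<close>

lemma edges_outside_star: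
  fixes c \<epsilon> :: real and L :: nat
  assumes r: "4 \<le> r" and F: "F \<subseteq> vertices n r" and cardF: "card F = Suc ((n - 2) choose (r - 2))"
    and p: "p \<subseteq> {1..n}" "card p = 2"
    and c: "0 < c" "8 * \<epsilon> \<le> c\<^sup>2" and n: "r + 2 \<le> n"
    and few: "real (card (F - star n r p)) \<le> \<epsilon> * real n ^ (r - 2)"
    and D: "2 * r * c * real n ^ (r - 3) \<le> real ((n - (r + 2)) choose (r - 3))"
      "2 * L \<le> (n - (r + 2)) choose (r - 3)"
    and D': "real L + \<epsilon> * real n ^ (r - 2) < real ((n - (r + 1)) choose (r - 2))"
    and L: "24 * real (r * (L + 1)) ^ 3 \<le> c * real n"
  shows "L * card (F - star n r p) \<le> 4 * card (inner_edges (intersection_graph n r 1) F)"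
proof (rule ccontr)
  let ?S = "star n r p"
  let ?e = "card (inner_edges (intersection_graph n r 1) F)"
  let ?deg = "\<lambda>A. card {B \<in> F. card (A \<inter> B) = 1}"
  define k where "k = card (F - ?S)"
  define B where "B = {X \<in> F - ?S. ?deg X \<le> L}"
  define Z where "Z = \<Union>B"
  assume "\<not> L * card (F - ?S) \<le> 4 * ?e"
  then have few_edges: "4 * ?e < L * k"
    by (simp add: k_def)
  have finF: "finite F"
    using F finite_vertices by (rule finite_subset)
  have finS: "finite ?S"
    by (simp add: star_def)
  have finSA: "\<And>A. A \<in> ?S \<Longrightarrow> finite A"
    by (auto simp: star_def intro: finite_subset)
  have finp: "finite p"
    using p(1) by (rule finite_subset) simp
  have "card F = card (F - ?S) + card (F \<inter> ?S)" "card ?S = card (?S - F) + card (?S \<inter> F)"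
    using finF finS by (simp_all add: card_Diff_subset_Int card_mono)
  \<comment> \<open>\<open>F\<close> has one member more than the star, so it has one more member
    outside the star than the star has outside \<open>F\<close>.\<close>
  then have k: "k = Suc (card (?S - F))"
    using cardF card_star[OF p, of r] r by (simp add: k_def Int_commute)
  \<comment> \<open>Members of degree above \<open>L\<close> make up less than half of
    \<open>k\<close>, since each accounts for at least \<open>L / 2\<close> edges.\<close>
  have low: "k < 2 * card B"
  proof -
    let ?H = "{A \<in> F. L < ?deg A}"
    have "F - ?S \<subseteq> B \<union> ?H"
      by (auto simp: B_def)
    then have H: "k \<le> card B + card ?H"
      unfolding k_def using finF
      by (intro order_trans[OF card_mono card_Un_le]) (auto simp: B_def)
    have "card ?H * L \<le> 2 * ?e"
      using r by (intro card_high_degree[OF F]) simp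
    then have "2 * (card ?H * L) < L * k"
      using few_edges by linarith
    moreover have "2 * (card ?H * L) = L * (2 * card ?H)"
      by simp
    ultimately have "L * (2 * card ?H) < L * k"
      by linarith
    then have "2 * card ?H < k"
      by (rule mult_less_cancel1[THEN iffD1, THEN conjunct2])
    then show ?thesis using H by linarith
  qed
  have B: "X \<subseteq> {1..n}" "card X = r" "finite X" "?deg X \<le> L" "X \<in> F" "X \<in> B" if "X \<in> B" for X
    using that F by (auto simp: B_def intro: finite_subset)
  \<comment> \<open>A member of \<open>B\<close> has at most \<open>L\<close> neighbours in
    \<open>F\<close>, so all but \<open>L\<close> of its neighbours in the star are missing from
    \<open>F\<close>.\<close>
  have lower: "card (N - (?S - F)) \<le> L" if "X \<in> B" "N \<subseteq> ?S" "\<And>A. A \<in> N \<Longrightarrow> card (X \<inter> A) = 1" for X N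
  proof -
    have "card (N - (?S - F)) \<le> ?deg X"
      using that finF by (intro card_mono) auto
    then show ?thesis
      using B(4)[OF that(1)] by linarith
  qed
  \<comment> \<open>If \<open>X\<close> met \<open>p\<close> in one point, every star member
    avoiding the rest of \<open>X\<close> would be a neighbour. By \<open>D'\<close> these outnumber
    the \<open>L\<close> permitted neighbours and the missing star members together.\<close>
  have disj: "X \<inter> p = {}" if X: "X \<in> B" for X
  proof (rule ccontr)
    assume ne: "X \<inter> p \<noteq> {}"
    have "\<not> p \<subseteq> X"
      using X F by (auto simp: B_def star_def)
    then have "X \<inter> p \<subset> p" by blast
    then have "card (X \<inter> p) < 2"
      using psubset_card_mono[OF finp] p(2) by metis
    moreover have "card (X \<inter> p) \<noteq> 0"
      using ne finp by simp
    ultimately have 1: "card (X \<inter> p) = 1" by linarith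
    let ?N = "{A. A \<subseteq> {1..n} \<and> card A = r \<and> A \<inter> (X \<union> p) = p}"
    have "card (X \<union> p) = r + 1"
      using card_Un_Int[OF B(3)[OF X] finp] 1 B(2)[OF X] p(2) by simp
    then have "card ?N = (n - (r + 1)) choose (r - 2)"
      using card_subsets_with_trace[of "{1..n}" "X \<union> p" p r] B(1)[OF X] p r by simp
    moreover have "card (?N - (?S - F)) \<le> L"
    proof (rule lower[OF X])
      show "?N \<subseteq> ?S" by (auto simp: star_def)
      show "card (X \<inter> A) = 1" if "A \<in> ?N" for A
      proof -
        have "X \<inter> A = X \<inter> p" using that by blast
        then show ?thesis using 1 by simp
      qed
    qed
    moreover have "card ?N \<le> card (?N - (?S - F)) + card (?S - F)"
      using diff_card_le_card_Diff[of "?S - F" ?N] finS by simp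
    moreover have "real (card (?S - F)) \<le> \<epsilon> * real n ^ (r - 2)"
      using few k by (simp add: k_def[symmetric])
    ultimately show False
      using D' by linarith
  qed
  have ZB: "finite Z" "Z \<subseteq> {1..n}"
    using B finite_subset[of Z "{1..n}"] by (auto simp: Z_def)
  \<comment> \<open>The ground set consists of the covered points only, so that the structural bound
    is in terms of \<open>card Z\<close> rather than \<open>n\<close>.\<close>
  interpret sparse_family Z B r L
  proof
    show "B \<subseteq> {A. A \<subseteq> Z \<and> card A = r}"
      using B(2) by (auto simp: Z_def)
    show "card {Y \<in> B. card (X \<inter> Y) = 1} \<le> L" if "X \<in> B" for X
    proof -
      have "card {Y \<in> B. card (X \<inter> Y) = 1} \<le> ?deg X"
        using finF by (intro card_mono) (auto simp: B_def)
      then show ?thesis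
        using B(4)[OF that] by linarith
    qed
  qed (use ZB r in auto)
  let ?D = "(n - (r + 2)) choose (r - 3)"
  \<comment> \<open>The sets in \<open>N u\<close> contain \<open>p\<close> and meet
    \<open>f u\<close> in \<open>u\<close> alone. They are neighbours of the low-degree member
    \<open>f u\<close>, so at most \<open>L\<close> of them belong to \<open>F\<close>.\<close>
  define f where "f u = (SOME X. X \<in> B \<and> u \<in> X)" for u
  define N where "N u = {A. A \<subseteq> {1..n} \<and> card A = r \<and> A \<inter> (f u \<union> p) = insert u p}" for u
  have f: "f u \<in> B" "u \<in> f u" if "u \<in> Z" for u
    using someI_ex[of "\<lambda>X. X \<in> B \<and> u \<in> X"] that by (auto simp: Z_def f_def)
  have N: "?D \<le> card (N u \<inter> (?S - F)) + L" if u: "u \<in> Z" for u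
  proof -
    have up: "u \<notin> p"
      using disj f u by blast
    have "card (f u \<union> p) = r + 2"
      using card_Un_disjoint[OF B(3)[OF f(1)[OF u]] finp disj[OF f(1)[OF u]]] B(2)[OF f(1)[OF u]] p(2)
      by simp
    then have "card (N u) = ?D"
      using card_subsets_with_trace[of "{1..n}" "f u \<union> p" "insert u p" r] B(1)[OF f(1)[OF u]]
        f(2)[OF u] p r up finp by (auto simp: N_def)
    moreover have "card (N u - (?S - F)) \<le> L"
    proof (rule lower[OF f(1)[OF u]])
      show "N u \<subseteq> ?S" by (auto simp: star_def N_def)
      show "card (f u \<inter> A) = 1" if "A \<in> N u" for A
      proof -
        have "f u \<inter> A = {u}"
          using that disj[OF f(1)[OF u]] f(2)[OF u] by (auto simp: N_def)
        then show ?thesis by simp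
      qed
    qed
    moreover have "finite (N u)"
      by (rule finite_subset[OF _ finite_vertices[of n r]]) (auto simp: N_def)
    then have "card (N u) = card (N u \<inter> (?S - F)) + card (N u - (?S - F))"
      by (rule card_Int_Diff)
    ultimately show ?thesis by linarith
  qed
  \<comment> \<open>Double counting of pairs of a covered point \<open>u\<close> and a missing star
    member in \<open>N u\<close>: such a member contains \<open>u\<close>, hence is counted at most
    \<open>r\<close> times.\<close>
  have "card Z * (?D - L) \<le> (\<Sum>u\<in>Z. card (N u \<inter> (?S - F)))"
    using sum_mono[of Z "\<lambda>_. ?D - L" "\<lambda>u. card (N u \<inter> (?S - F))"] N by (simp add: le_diff_conv)
  also have "\<dots> = card (SIGMA u:Z. N u \<inter> (?S - F))"
    using ZB finS by simp
  also have "\<dots> \<le> card (SIGMA A:(?S - F). A)"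
  proof (rule card_inj_on_le[where f = "\<lambda>(u, A). (A, u)"])
    show "finite (SIGMA A:(?S - F). A)"
      using finS finSA by blast
  qed (auto simp: inj_on_def N_def)
  also have "\<dots> = (\<Sum>A\<in>?S - F. card A)"
    using finS finSA by (intro card_SigmaI) blast+
  also have "\<dots> = card (?S - F) * r"
    by (simp add: star_def)
  also have "\<dots> \<le> k * r"
    using k by simp
  finally have "card Z * (2 * (?D - L)) \<le> 2 * r * k"
    by (simp add: mult.commute)
  moreover have "card Z * ?D \<le> card Z * (2 * (?D - L))"
    using D(2) by (intro mult_left_mono) auto
  ultimately have "real (card Z * ?D) \<le> real (2 * r * k)"
    by (intro of_nat_mono) linarith
  then have "real (card Z) * real ?D \<le> 2 * real r * real k"
    by simp
  moreover have "real (card Z) * (2 * r * c * real n ^ (r - 3)) \<le> real (card Z) * real ?D"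
    using D(1) by (intro mult_left_mono) auto
  ultimately have "(2 * real r) * (c * real (card Z) * real n ^ (r - 3)) \<le> (2 * real r) * real k"
    by (simp add: ac_simps)
  then have many: "c * real (card Z) * real n ^ (r - 3) \<le> real k"
    using r by (simp add: mult_le_cancel_left)
  define j where "j = r - 4"
  have j: "r - 2 = Suc (Suc j)" "r - 3 = Suc j"
    using r by (auto simp: j_def)
  have n0: "0 < real n"
    using n by simp
  \<comment> \<open>Comparing the lower bound for \<open>k\<close> with the hypothesis
    \<open>few\<close> shows that \<open>Z\<close> is small compared with \<open>n\<close>.\<close>
  have "c * real (card Z) * real n ^ (r - 3) \<le> \<epsilon> * real n * real n ^ (r - 3)"
    using many few by (simp add: k_def[symmetric] j ac_simps)
  then have "c * real (card Z) \<le> \<epsilon> * real n"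
    using n0 by simp
  then have "8 * (c * real (card Z)) \<le> c\<^sup>2 * real n"
    using mult_right_mono[OF c(2), of "real n"] by simp
  then have "c * (8 * real (card Z)) \<le> c * (c * real n)"
    by (simp add: power2_eq_square ac_simps)
  then have small: "8 * real (card Z) \<le> c * real n"
    using c(1) by simp
  have Zpos: "0 < real (card Z)"
  proof -
    have "B \<noteq> {}"
      using low by auto
    then obtain X where X: "X \<in> B" by blast
    then have "X \<noteq> {}"
      using B(2)[OF X] r by auto
    then have "Z \<noteq> {}"
      using X by (auto simp: Z_def)
    then show ?thesis
      using ZB by (simp add: card_gt_0_iff)
  qed
  have Zn: "real (card Z) \<le> real n"
    using card_mono[OF _ ZB(2)] by simp
  have "real k < 2 * real (card B)"
    using low by linarith
  also have "\<dots> \<le> 2 * real (6 * M ^ 3 * card Z ^ (r - 3) + 2 * card Z ^ (r - 2))"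
    using card_family_le by (intro mult_left_mono of_nat_mono) auto
  also have "\<dots> = real (card Z) * (real (card Z) ^ j * (12 * real M ^ 3 + 4 * real (card Z)))"
    by (simp add: j algebra_simps)
  \<comment> \<open>Each of the two terms in the last factor is at most half of
    \<open>c * real n\<close>, by \<open>L\<close> and by \<open>small\<close>.\<close>
  also have "\<dots> \<le> real (card Z) * (real n ^ j * (c * real n))"
    using L small Zn by (intro mult_left_mono mult_mono power_mono) (auto simp: M_def)
  also have "\<dots> = c * real (card Z) * real n ^ (r - 3)"
    by (simp add: j)
  finally show False
    using many by linarith
qed

subsection \<open>Edges and distance to a star\<close>

text \<open>Either \<open>F\<close> spans so many edges that any pair will do, or removing the few
  members of large degree leaves a sparse family of nearly extremal size, which is close to a
  star.\<close>

lemma edges_ge_distance_to_star: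
  assumes r: "4 \<le> r"
  shows "\<exists>(C::nat) (K::real). 0 < C \<and> 0 < K \<and> eventually (\<lambda>n. \<forall>L F.
    K * real (L + 1) ^ 3 \<le> real n \<longrightarrow> F \<subseteq> vertices n r \<longrightarrow> card F = Suc ((n - 2) choose (r - 2)) \<longrightarrow>
    (\<exists>p. p \<subseteq> {1..n} \<and> card p = 2 \<and>
      L * card (F - star n r p) \<le> C * card (inner_edges (intersection_graph n r 1) F))) sequentially"
proof -
  define a b where "a = (fact (r - 3) :: real)" and "b = (fact (r - 2) :: real)"
  \<comment> \<open>\<open>2 * r * c\<close> is half the leading coefficient \<open>1 / a\<close> of
    the binomials with lower index \<open>r - 3\<close>. Of the two bounds in
    \<open>\<epsilon>\<close>, the first makes the set of covered points small and the second
    excludes low-degree members meeting \<open>p\<close> in one point. The 41 is 40 from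
    \<open>most_contain_pair\<close> plus 1 for the members of large degree.\<close>
  define c where "c = 1 / (4 * real r * a)"
  define \<epsilon> where "\<epsilon> = min (c\<^sup>2 / 8) (1 / (4 * b))"
  define \<delta> where "\<delta> = \<epsilon> / 41"
  define C where "C = nat \<lceil>4 / \<delta>\<rceil> + 4"
  \<comment> \<open>The summands provide, in order, the hypothesis on \<open>M\<close> in
    \<open>most_contain_pair\<close> and the conditions \<open>L\<close>, \<open>D'\<close> and
    \<open>2 * L \<le> ...\<close> in \<open>edges_outside_star\<close>.\<close>
  define K where "K = 6 * real r ^ 3 * b / \<delta> + 24 * real r ^ 3 / c + 4 * b + 4 * a"
  have ab: "1 \<le> a" "1 \<le> b"
    by (simp_all add: a_def b_def fact_ge_1)
  have c: "0 < c"
    using ab r by (simp add: c_def)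
  have \<epsilon>: "0 < \<epsilon>" "8 * \<epsilon> \<le> c\<^sup>2" "\<epsilon> * b \<le> 1 / 4"
  proof -
    show "0 < \<epsilon>" using c ab by (simp add: \<epsilon>_def)
    show "8 * \<epsilon> \<le> c\<^sup>2" by (simp add: \<epsilon>_def min_def)
    have "\<epsilon> * b \<le> (1 / (4 * b)) * b"
      using ab by (intro mult_right_mono) (auto simp: \<epsilon>_def)
    then show "\<epsilon> * b \<le> 1 / 4" using ab by simp
  qed
  have "\<epsilon> \<le> \<epsilon> * b"
    using ab \<epsilon>(1) by simp
  then have \<delta>: "0 < \<delta>" "\<delta> < 1 / 3"
    using \<epsilon>(1,3) unfolding \<delta>_def by linarith+
  have C: "4 / \<delta> \<le> real C" "4 \<le> C"
    by (auto simp: C_def) linarith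
  have Kparts: "0 < 6 * real r ^ 3 * b / \<delta>" "0 < 24 * real r ^ 3 / c" "0 < 4 * b" "0 < 4 * a"
    using ab c \<delta> r by auto
  then have K: "0 < K"
    by (simp add: K_def)
  have Kle: "6 * real r ^ 3 * b / \<delta> \<le> K" "24 * real r ^ 3 / c \<le> K" "4 * b \<le> K" "4 * a \<le> K"
    using Kparts unfolding K_def by linarith+
  have half: "0 < (1 / 2 :: real)"
    by simp
  have "eventually (\<lambda>n. \<forall>L F.
    K * real (L + 1) ^ 3 \<le> real n \<longrightarrow> F \<subseteq> vertices n r \<longrightarrow> card F = Suc ((n - 2) choose (r - 2)) \<longrightarrow>
    (\<exists>p. p \<subseteq> {1..n} \<and> card p = 2 \<and>
      L * card (F - star n r p) \<le> C * card (inner_edges (intersection_graph n r 1) F))) sequentially"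
    using eventually_choose_ge[OF \<delta>(1), where s = "r - 2" and a = 2]
      eventually_choose_ge[OF half, where s = "r - 3" and a = "r + 2"]
      eventually_choose_ge[OF half, where s = "r - 2" and a = "r + 1"]
      eventually_ge_at_top[of "r + 2"]
  proof eventually_elim
    case (elim n)
    note big = elim(1-3)[folded a_def b_def] and n = elim(4)
    show ?case
    proof (intro allI impI)
      fix L F
      assume KL: "K * real (L + 1) ^ 3 \<le> real n" and F: "F \<subseteq> vertices n r"
        and cardF: "card F = Suc ((n - 2) choose (r - 2))"
      let ?m = "(n - 2) choose (r - 2)"
      let ?e = "card (inner_edges (intersection_graph n r 1) F)"
      let ?deg = "\<lambda>A. card {B \<in> F. card (A \<inter> B) = 1}"
      have L1: "real (L + 1) \<le> real (L + 1) ^ 3"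
        by (rule self_le_power) auto
      have KL': "t * real (L + 1) ^ 3 \<le> real n" if "t \<le> K" for t
        by (rule order_trans[OF mult_right_mono[OF that] KL]) simp
      have KL'': "t * real (L + 1) \<le> real n" if "t \<le> K" "0 < t" for t
        using that(2) by (intro order_trans[OF mult_left_mono[OF L1] KL'[OF that(1)]]) simp
      have n1: "1 \<le> real n" "2 \<le> n"
        using n by auto
      have npow: "real n \<le> real n ^ (r - 2)" "real n \<le> real n ^ (r - 3)"
        using n1 r by (auto intro!: self_le_power)
      have m: "real ?m \<le> real n ^ (r - 2)" "1 \<le> ?m"
      proof -
        have "?m \<le> n ^ (r - 2)"
          using choose_le_power[of "n - 2" "r - 2"] power_mono[of "n - 2" n "r - 2"] by simp
        then show "real ?m \<le> real n ^ (r - 2)"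
          by (metis of_nat_le_iff of_nat_power)
        show "1 \<le> ?m"
          using n by (simp add: Suc_le_eq)
      qed
      have finF: "finite F"
        using F finite_vertices by (rule finite_subset)
      show "\<exists>p. p \<subseteq> {1..n} \<and> card p = 2 \<and> L * card (F - star n r p) \<le> C * ?e"
      proof (cases "2 * real ?e \<le> \<delta> * L * ?m \<and> 0 < L")
        case False
        \<comment> \<open>For positive \<open>L\<close> there are more than
          \<open>\<delta> * L * ?m / 2\<close> edges, while at most
          \<open>?m + 1 \<le> 2 * ?m\<close> members lie outside any star. This accounts for
          \<open>4 / \<delta>\<close> in \<open>C\<close>.\<close>
        have "L * card (F - star n r {1, 2}) \<le> C * ?e"
        proof (cases "L = 0")
          case L: False
          have "card (F - star n r {1, 2}) \<le> Suc ?m"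
            using card_mono[OF finF, of "F - star n r {1, 2}"] cardF by auto
          then have "real (card (F - star n r {1, 2})) \<le> 2 * real ?m"
            using m(2) by linarith
          then have "real L * real (card (F - star n r {1, 2})) \<le> real L * (2 * real ?m)"
            by (intro mult_left_mono) auto
          also have "\<dots> \<le> (4 / \<delta>) * real ?e"
            using False L \<delta> by (simp add: field_simps)
          also have "\<dots> \<le> real C * real ?e"
            using C by (intro mult_right_mono) auto
          finally show ?thesis
            by (metis of_nat_le_iff of_nat_mult)
        qed simp
        moreover have "{1, 2} \<subseteq> {1..n}" "card {1, 2 :: nat} = 2"
          using n1 by auto
        ultimately show ?thesis by blast
      next
        case True
        \<comment> \<open>As there are few edges, only \<open>\<delta> * ?m\<close> members at most
          are discarded here.\<close>
        define F' where "F' = {A \<in> F. ?deg A \<le> L}"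
        interpret sparse_family "{1..n}" F' r L
        proof
          show "card {B \<in> F'. card (A \<inter> B) = 1} \<le> L" if "A \<in> F'" for A
          proof -
            have "card {B \<in> F'. card (A \<inter> B) = 1} \<le> ?deg A"
              using finF by (intro card_mono) (auto simp: F'_def)
            then show ?thesis
              using that by (simp add: F'_def)
          qed
        qed (use F r in \<open>auto simp: F'_def\<close>)
        have FF': "F - F' = {A \<in> F. L < ?deg A}"
          by (auto simp: F'_def)
        have "real (card (F - F') * L) \<le> real (2 * ?e)"
          using card_high_degree[OF F, of L] r unfolding FF' by (intro of_nat_mono) simp
        moreover have "\<delta> * L * ?m = (\<delta> * ?m) * real L"
          by simp
        ultimately have "real (card (F - F')) * real L \<le> (\<delta> * ?m) * real L"
          using True unfolding of_nat_mult by linarith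
        then have high: "real (card (F - F')) \<le> \<delta> * ?m"
          using True by simp
        have "card F = card F' + card (F - F')"
          using finF by (simp add: F'_def card_Diff_subset card_mono)
        then have "(1 - \<delta>) * real ?m \<le> real (card F')"
          using high cardF by (simp add: algebra_simps)
        then have "(1 - \<delta>) * real ?m * b \<le> real (card F') * b"
          using ab by (intro mult_right_mono) auto
        moreover have "(1 - \<delta>) * ((1 - \<delta>) * real n ^ (r - 2)) \<le> (1 - \<delta>) * (real ?m * b)"
          using big(1) \<delta> by (intro mult_left_mono) auto
        moreover have "(1 - 2 * \<delta>) * real n ^ (r - 2) \<le> (1 - \<delta>) * ((1 - \<delta>) * real n ^ (r - 2))"
          using \<delta> by (simp add: algebra_simps)
        ultimately have large: "(1 - 2 * \<delta>) * real n ^ (r - 2) \<le> real (card F') * b"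
          by (simp add: mult.assoc)
        have "6 * real M ^ 3 * b = \<delta> * (6 * real r ^ 3 * b / \<delta> * real (L + 1) ^ 3)"
          unfolding M_def of_nat_mult power_mult_distrib using \<delta> by simp
        also have "\<dots> \<le> \<delta> * real n"
          using \<delta> by (intro mult_left_mono KL' Kle) simp
        finally obtain p where p: "p \<subseteq> {1..n}" "card p = 2"
          and out: "real (card {A \<in> F'. \<not> p \<subseteq> A}) * b \<le> 40 * \<delta> * real n ^ (r - 2)"
          using most_contain_pair[OF \<delta>] large n1 by (auto simp: b_def)
        have "real (card {A \<in> F'. \<not> p \<subseteq> A}) \<le> real (card {A \<in> F'. \<not> p \<subseteq> A}) * b"
          using ab by (simp add: mult_le_cancel_left1)
        then have out': "real (card {A \<in> F'. \<not> p \<subseteq> A}) \<le> 40 * \<delta> * real n ^ (r - 2)"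
          using out by linarith
        have "F - star n r p \<subseteq> (F - F') \<union> {A \<in> F'. \<not> p \<subseteq> A}"
          using F by (auto simp: star_def F'_def)
        then have "card (F - star n r p) \<le> card (F - F') + card {A \<in> F'. \<not> p \<subseteq> A}"
          using finF by (intro order_trans[OF card_mono card_Un_le]) (auto simp: F'_def)
        then have "real (card (F - star n r p)) \<le> \<delta> * ?m + 40 * \<delta> * real n ^ (r - 2)"
          using high out' by linarith
        also have "\<delta> * ?m \<le> \<delta> * real n ^ (r - 2)"
          using m(1) \<delta> by (intro mult_left_mono) auto
        finally have few: "real (card (F - star n r p)) \<le> \<epsilon> * real n ^ (r - 2)"
          by (simp add: \<delta>_def)
        have "L * card (F - star n r p) \<le> 4 * ?e"
        proof (rule edges_outside_star[OF r F cardF p c \<epsilon>(2) n few])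
          let ?D = "(n - (r + 2)) choose (r - 3)"
          have D: "real n ^ (r - 3) \<le> 2 * a * real ?D"
            using big(2) by (simp add: mult.commute mult.left_commute)
          show "2 * real r * c * real n ^ (r - 3) \<le> real ?D"
            using D ab r by (simp add: c_def field_simps)
          have "4 * a * real (L + 1) \<le> real n"
            using KL''[OF Kle(4) Kparts(4)] .
          then have "4 * a * real L \<le> real n"
            using ab by (simp add: algebra_simps)
          then have "(2 * a) * (2 * real L) \<le> (2 * a) * real ?D"
            using D npow(2) by linarith
          then have "2 * real L \<le> real ?D"
            using ab by simp
          then show "2 * L \<le> ?D" by linarith
          have eq: "(real L + \<epsilon> * real n ^ (r - 2)) * b = real L * b + (\<epsilon> * b) * real n ^ (r - 2)"
            by (simp add: algebra_simps)
          have "4 * b * real (L + 1) \<le> real n"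
            using KL''[OF Kle(3) Kparts(3)] .
          then have "4 * (real L * b) < real n"
            using ab by (simp add: algebra_simps)
          moreover have "(\<epsilon> * b) * real n ^ (r - 2) \<le> 1 / 4 * real n ^ (r - 2)"
            using \<epsilon>(3) by (intro mult_right_mono) auto
          moreover have "1 / 2 * real n ^ (r - 2) \<le> real ((n - (r + 1)) choose (r - 2)) * b"
            using big(3) by simp
          ultimately have "(real L + \<epsilon> * real n ^ (r - 2)) * b < real ((n - (r + 1)) choose (r - 2)) * b"
            using npow(1) unfolding eq by linarith
          then show "real L + \<epsilon> * real n ^ (r - 2) < real ((n - (r + 1)) choose (r - 2))"
            using ab by simp
          have "24 * real (r * (L + 1)) ^ 3 = c * (24 * real r ^ 3 / c * real (L + 1) ^ 3)"
            unfolding of_nat_mult power_mult_distrib using c by simp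
          also have "\<dots> \<le> c * real n"
            using c by (intro mult_left_mono KL' Kle) simp
          finally show "24 * real (r * (L + 1)) ^ 3 \<le> c * real n" .
        qed
        also have "\<dots> \<le> C * ?e"
          using C(2) by (intro mult_right_mono) auto
        finally show ?thesis
          using p by blast
      qed
    qed
  qed
  then show ?thesis
    using K C(2) by (intro exI[of _ C] exI[of _ K]) auto
qed

subsection \<open>The union bound\<close>

text \<open>All edges inside \<open>F\<close> have to be deleted, and these are independent events
  of probability 1/2.\<close>

lemma prob_independent_le:
  fixes G :: "'v graph"
  assumes "finite (snd G)" "\<And>e. e \<in> snd G \<Longrightarrow> \<exists>x y. e = {x, y}"
  shows "measure_pmf.prob (random_subgraph (1/2) G) {H. independent_set H F}
    \<le> (1/2) ^ card (inner_edges G F)"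
proof -
  let ?P = "Pi_pmf (snd G) False (\<lambda>_. bernoulli_pmf (1/2))"
  let ?B = "\<lambda>e. if e \<in> inner_edges G F then {False} else UNIV"
  have "measure_pmf.prob (random_subgraph (1/2) G) {H. independent_set H F}
      = measure_pmf.prob ?P {X. independent_set (fst G, {e \<in> snd G. X e}) F}"
    by (simp add: random_subgraph_def vimage_def)
  also have "\<dots> \<le> measure_pmf.prob ?P (Pi (snd G) ?B)"
  proof (rule measure_pmf.finite_measure_mono)
    show "{X. independent_set (fst G, {e \<in> snd G. X e}) F} \<subseteq> Pi (snd G) ?B"
    proof (intro subsetI Pi_I)
      fix X e assume X: "X \<in> {X. independent_set (fst G, {e \<in> snd G. X e}) F}" and e: "e \<in> snd G"
      show "X e \<in> ?B e"
        using assms(2)[OF e] X e by (auto simp: independent_set_def inner_edges_def)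
    qed
  qed simp
  also have "\<dots> = (\<Prod>e\<in>snd G. measure_pmf.prob (bernoulli_pmf (1/2)) (?B e))"
    using assms(1) by (rule measure_Pi_pmf_Pi)
  also have "\<dots> = (\<Prod>e\<in>snd G. if e \<in> inner_edges G F then 1/2 else 1)"
    by (intro prod.cong) (auto simp: measure_pmf_single)
  also have "\<dots> = (\<Prod>e\<in>inner_edges G F. 1/2)"
    using assms(1) by (subst prod.inter_restrict[symmetric]) (auto simp: inner_edges_def Int_def intro!: prod.cong)
  also have "\<dots> = (1/2) ^ card (inner_edges G F)"
    by simp
  finally show ?thesis .
qed

text \<open>Subsets of independent sets are independent, so it is enough to exclude the size
  \<open>Suc m\<close>.\<close>

lemma independence_number_eqI:
  assumes "finite (fst H)" "independent_set H S" "card S = m"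
    and "\<And>F. \<lbrakk>F \<subseteq> fst H; card F = Suc m\<rbrakk> \<Longrightarrow> \<not> independent_set H F"
  shows "independence_number H = m"
  unfolding independence_number_def
proof (rule Max_eqI)
  have "{S. independent_set H S} \<subseteq> Pow (fst H)"
    by (auto simp: independent_set_def)
  then show "finite (card ` {S. independent_set H S})"
    using assms(1) by (meson finite_Pow_iff finite_imageI finite_subset)
  show "m \<in> card ` {S. independent_set H S}"
    using assms(2,3) by auto
  show "k \<le> m" if k: "k \<in> card ` {S. independent_set H S}" for k
  proof (rule ccontr)
    assume "\<not> k \<le> m"
    moreover obtain T where T: "independent_set H T" "k = card T"
      using k by blast
    ultimately have "Suc m \<le> card T"
      by simp
    from obtain_subset_with_card_n[OF this] obtain F where F: "F \<subseteq> T" "card F = Suc m"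
      by metis
    have "independent_set H F"
      using T(1) F(1) unfolding independent_set_def by blast
    then show False
      using assms(4)[of F] F by (simp add: independent_set_def)
  qed
qed

lemma star_independent:
  assumes "E \<subseteq> snd (intersection_graph n r 1)" "card p = 2"
  shows "independent_set (vertices n r, E) (star n r p)"
proof -
  have "{A, B} \<notin> E" if "A \<in> star n r p" "B \<in> star n r p" for A B
  proof
    assume "{A, B} \<in> E"
    then have "{A, B} \<in> snd (intersection_graph n r 1)"
      using assms(1) by blast
    then obtain X Y where "{A, B} = {X, Y}" "card (X \<inter> Y) = 1"
      by (auto simp: intersection_graph_def Let_def)
    then have "card (A \<inter> B) = 1"
      by (auto simp: doubleton_eq_iff Int_commute)
    moreover have "p \<subseteq> A \<inter> B"
      using that by (auto simp: star_def)
    moreover have "finite (A \<inter> B)"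
      using \<open>card (A \<inter> B) = 1\<close> by (intro card_ge_0_finite) simp
    ultimately show False
      using assms(2) card_mono[of "A \<inter> B" p] by simp
  qed
  then show ?thesis
    by (auto simp: independent_set_def star_def)
qed

lemma sum_Pow_power_card:
  fixes s :: real
  assumes "finite V"
  shows "(\<Sum>F\<in>Pow V. s ^ card F) = (1 + s) ^ card V"
  using prod_add[OF assms, of "\<lambda>_. s" "\<lambda>_. 1"] by (simp add: add.commute)

text \<open>As \<open>F\<close> has one element more than \<open>S\<close>, their symmetric
  difference has \<open>2 * card (F - S) - 1\<close> elements, which leaves one factor
  \<open>s\<close>. Taking the symmetric difference with \<open>S\<close> is an involution on the
  subsets of \<open>V\<close>, so the sum is at most a full binomial expansion.\<close>

lemma sum_power_distance_le:
  fixes s :: real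
  assumes V: "finite V" "S \<subseteq> V" and s: "0 \<le> s"
  shows "(\<Sum>F | F \<subseteq> V \<and> card F = Suc (card S). s ^ (2 * card (F - S))) \<le> s * (1 + s) ^ card V"
proof -
  let ?sd = "\<lambda>F. (F - S) \<union> (S - F)"
  have fin: "finite F" if "F \<subseteq> V" for F
    using that V(1) by (rule finite_subset)
  have "(\<Sum>F | F \<subseteq> V \<and> card F = Suc (card S). s ^ (2 * card (F - S)))
      = (\<Sum>F | F \<subseteq> V \<and> card F = Suc (card S). s * s ^ card (?sd F))"
  proof (intro sum.cong refl)
    fix F assume "F \<in> {F. F \<subseteq> V \<and> card F = Suc (card S)}"
    then have F: "F \<subseteq> V" "card F = Suc (card S)" by auto
    have "card F = card (F \<inter> S) + card (F - S)" "card S = card (S \<inter> F) + card (S - F)"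
      by (rule card_Int_Diff[OF fin[OF F(1)]], rule card_Int_Diff[OF fin[OF V(2)]])
    then have "card (F - S) = Suc (card (S - F))"
      using F(2) by (simp add: Int_commute)
    moreover have "card (?sd F) = card (F - S) + card (S - F)"
      using fin F V(2) by (intro card_Un_disjoint) auto
    ultimately have "2 * card (F - S) = Suc (card (?sd F))"
      by simp
    then show "s ^ (2 * card (F - S)) = s * s ^ card (?sd F)"
      by (simp only: power_Suc)
  qed
  also have "\<dots> \<le> (\<Sum>F\<in>Pow V. s * s ^ card (?sd F))"
    using V(1) s by (intro sum_mono2) auto
  also have "\<dots> = s * (\<Sum>F\<in>Pow V. s ^ card (?sd F))"
    by (simp add: sum_distrib_left)
  also have "(\<Sum>F\<in>Pow V. s ^ card (?sd F)) = (\<Sum>F\<in>Pow V. s ^ card F)"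
    using V(2) by (intro sum.reindex_bij_witness[where i = ?sd and j = ?sd]) auto
  also have "\<dots> = (1 + s) ^ card V"
    using V(1) by (rule sum_Pow_power_card)
  finally show ?thesis .
qed

theorem theorem2:
  fixes r :: nat
  assumes "r \<ge> 4"
  shows "(\<lambda>n. measure_pmf.prob (random_subgraph (1/2) (intersection_graph n r 1))
            {G. independence_number G = (n - 2) choose (r - 2)}) \<longlonglongrightarrow> 1"
proof -
  obtain C :: nat and K :: real where C: "0 < C" and K: "0 < K" and ev: "eventually (\<lambda>n. \<forall>L F.
    K * real (L + 1) ^ 3 \<le> real n \<longrightarrow> F \<subseteq> vertices n r \<longrightarrow> card F = Suc ((n - 2) choose (r - 2)) \<longrightarrow>
    (\<exists>p. p \<subseteq> {1..n} \<and> card p = 2 \<and>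
      L * card (F - star n r p) \<le> C * card (inner_edges (intersection_graph n r 1) F))) sequentially"
    using edges_ge_distance_to_star[OF assms] by blast
  \<comment> \<open>Logarithmic in \<open>n\<close>, yet \<open>2 ^ l n\<close> is at least
    \<open>n ^ r\<close> and thus at least the number of vertices.\<close>
  define l where "l n = nat \<lceil>real r * log 2 (real n)\<rceil>" for n
  define P where "P n = measure_pmf.prob (random_subgraph (1/2) (intersection_graph n r 1))
            {G. independence_number G = (n - 2) choose (r - 2)}" for n
  \<comment> \<open>The degree bound \<open>L\<close> will be \<open>2 * C * l n\<close>; the cube
    of \<open>L + 1\<close> is polylogarithmic, so the condition involving \<open>K\<close> holds
    eventually.\<close>
  have "((\<lambda>n. K * (2 * real C * (real r * log 2 (real n) + 1) + 1) ^ 3 / real n) \<longlongrightarrow> 0) sequentially"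
    using K C assms by real_asymp
  then have "eventually (\<lambda>n. K * (2 * real C * (real r * log 2 (real n) + 1) + 1) ^ 3 / real n < 1) sequentially"
    by (intro order_tendstoD) auto
  then have "eventually (\<lambda>n. 1 - 3 / real n \<le> P n) sequentially"
    using ev eventually_ge_at_top[of 2]
  proof eventually_elim
    case (elim n)
    let ?G = "intersection_graph n r 1"
    let ?V = "vertices n r"
    let ?m = "(n - 2) choose (r - 2)"
    let ?FF = "{F. F \<subseteq> ?V \<and> card F = Suc ?m}"
    let ?pairs = "{p. p \<subseteq> {1..n} \<and> card p = 2}"
    let ?e = "\<lambda>F. card (inner_edges ?G F)"
    define s where "s = (1/2 :: real) ^ l n"
    have n: "2 \<le> n" using elim(3) .
    have fstG: "fst ?G = ?V"
      by (simp add: intersection_graph_def Let_def)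
    have log: "0 \<le> log 2 (real n)"
      using n by simp
    have lr: "real (l n) \<le> real r * log 2 (real n) + 1" "real r * log 2 (real n) \<le> real (l n)"
      using log by (auto simp: l_def)
    have "K * real (2 * C * l n + 1) ^ 3 \<le> K * (2 * real C * (real r * log 2 (real n) + 1) + 1) ^ 3"
      using K lr(1) by (intro mult_left_mono power_mono) (auto intro: mult_left_mono)
    also have "\<dots> \<le> real n"
      using elim(1) n by (simp add: field_simps)
    finally have Kl: "K * real (2 * C * l n + 1) ^ 3 \<le> real n" .
    have "real n ^ r = (2 powr log 2 (real n)) powr real r"
      using n by (simp add: powr_realpow)
    also have "\<dots> = 2 powr (real r * log 2 (real n))"
      unfolding powr_powr by (simp add: mult.commute)
    also have "\<dots> \<le> 2 powr real (l n)"
      using lr(2) by (intro powr_mono) auto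
    finally have "real n ^ r \<le> 2 ^ l n"
      by (simp add: powr_realpow)
    then have s: "0 \<le> s" "s \<le> 1 / real n ^ r"
      using n by (auto simp: s_def field_simps)
    \<comment> \<open>The \<open>C\<close> in \<open>L\<close> cancels, and the 2 yields the
      exponent \<open>2 * card (F - star n r p)\<close>. Summing over all pairs avoids choosing
      \<open>p\<close> in terms of \<open>F\<close>.\<close>
    have step: "(1/2) ^ ?e F \<le> (\<Sum>p\<in>?pairs. s ^ (2 * card (F - star n r p)))" if F: "F \<in> ?FF" for F
    proof -
      obtain p where p: "p \<in> ?pairs"
        "(2 * C * l n) * card (F - star n r p) \<le> C * ?e F"
        using elim(2)[rule_format, of "2 * C * l n" F] Kl F by blast
      have "C * (l n * (2 * card (F - star n r p))) \<le> C * ?e F"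
        using p(2) by (simp only: ac_simps)
      then have "l n * (2 * card (F - star n r p)) \<le> ?e F"
        using C by simp
      then have "(1/2 :: real) ^ ?e F \<le> (1/2) ^ (l n * (2 * card (F - star n r p)))"
        by (intro power_decreasing) auto
      also have "\<dots> = s ^ (2 * card (F - star n r p))"
        by (simp add: s_def power_mult)
      also have "\<dots> \<le> (\<Sum>p\<in>?pairs. s ^ (2 * card (F - star n r p)))"
        using p(1) s(1) by (intro member_le_sum) auto
      finally show ?thesis .
    qed
    have "1 - P n = measure_pmf.prob (random_subgraph (1/2) ?G) {H. independence_number H \<noteq> ?m}"
      unfolding P_def using measure_pmf.prob_neg[of "random_subgraph (1/2) ?G" "\<lambda>H. independence_number H = ?m"]
      by simp
    \<comment> \<open>The star of \<open>{1, 2}\<close> stays independent in every subgraph, so the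
      independence number can only fail by being too large.\<close>
    also have "\<dots> \<le> measure_pmf.prob (random_subgraph (1/2) ?G) (\<Union>F\<in>?FF. {H. independent_set H F})"
    proof (rule measure_pmf.finite_measure_mono_AE, rule AE_pmfI, rule impI)
      fix H assume H: "H \<in> set_pmf (random_subgraph (1/2) ?G)" "H \<in> {H. independence_number H \<noteq> ?m}"
      then obtain X where "H = (fst ?G, {e \<in> snd ?G. X e})"
        by (auto simp: random_subgraph_def)
      then obtain E where E: "H = (?V, E)" "E \<subseteq> snd ?G"
        unfolding fstG by blast
      show "H \<in> (\<Union>F\<in>?FF. {H. independent_set H F})"
      proof (rule ccontr)
        assume "H \<notin> (\<Union>F\<in>?FF. {H. independent_set H F})"
        then have no: "\<not> independent_set H F" if "F \<subseteq> fst H" "card F = Suc ?m" for F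
          using that E by auto
        have "independence_number H = ?m"
        proof (rule independence_number_eqI[OF _ _ _ no])
          show "finite (fst H)"
            using E by simp
          show "independent_set H (star n r {1, 2})"
            unfolding E(1) using E(2) by (intro star_independent) auto
          show "card (star n r {1, 2}) = ?m"
            using n assms by (intro card_star) auto
        qed
        then show False
          using H(2) by simp
      qed
    qed simp
    also have "\<dots> \<le> (\<Sum>F\<in>?FF. measure_pmf.prob (random_subgraph (1/2) ?G) {H. independent_set H F})"
      by (intro measure_pmf.finite_measure_subadditive_finite) auto
    also have "\<dots> \<le> (\<Sum>F\<in>?FF. (1/2) ^ ?e F)"
      by (intro sum_mono prob_independent_le finite_edges) (auto simp: intersection_graph_def Let_def)
    also have "\<dots> \<le> (\<Sum>F\<in>?FF. \<Sum>p\<in>?pairs. s ^ (2 * card (F - star n r p)))"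
      by (intro sum_mono step)
    also have "\<dots> = (\<Sum>p\<in>?pairs. \<Sum>F\<in>?FF. s ^ (2 * card (F - star n r p)))"
      by (rule sum.swap)
    also have "\<dots> \<le> (\<Sum>p\<in>?pairs. s * (1 + s) ^ card ?V)"
    proof (rule sum_mono)
      fix p assume "p \<in> ?pairs"
      then have "card (star n r p) = ?m"
        using assms by (intro card_star) auto
      then show "(\<Sum>F\<in>?FF. s ^ (2 * card (F - star n r p))) \<le> s * (1 + s) ^ card ?V"
        using sum_power_distance_le[OF finite_vertices star_subset s(1), of n r p] by simp
    qed
    \<comment> \<open>There are at most \<open>n ^ r\<close> vertices and \<open>s\<close> is at
      most \<open>1 / n ^ r\<close>, so the power of \<open>1 + s\<close> is at most
      \<open>exp 1\<close>.\<close>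
    also have "\<dots> \<le> (\<Sum>p\<in>?pairs. 1 / real n ^ r * 3)"
    proof (intro sum_mono mult_mono s)
      have "real (card ?V) \<le> real n ^ r"
        using choose_le_power[of n r] by (simp add: n_subsets flip: of_nat_power)
      then have "real (card ?V) * s \<le> real n ^ r * (1 / real n ^ r)"
        using s by (intro mult_mono) auto
      then have Vs: "real (card ?V) * s \<le> 1"
        using n by simp
      have "(1 + s) ^ card ?V \<le> exp s ^ card ?V"
        using s(1) by (intro power_mono) auto
      also have "\<dots> = exp (real (card ?V) * s)"
        by (simp add: exp_of_nat_mult)
      also have "\<dots> \<le> exp 1"
        using Vs by simp
      also have "\<dots> \<le> 3"
        by (rule exp_le)
      finally show "(1 + s) ^ card ?V \<le> 3" .
    qed (use s in auto)
    also have "\<dots> = real (n choose 2) * (1 / real n ^ r * 3)"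
      by (simp add: n_subsets)
    also have "\<dots> \<le> real n ^ 2 * (1 / real n ^ r * 3)"
      using choose_le_power[of n 2] by (intro mult_right_mono) (auto simp flip: of_nat_power)
    also have "\<dots> \<le> 3 / real n"
    proof -
      have "real n ^ 3 \<le> real n ^ r"
        using n assms by (intro power_increasing) auto
      then show ?thesis
        using n by (simp add: field_simps power2_eq_square power3_eq_cube)
    qed
    finally show ?case by simp
  qed
  moreover have "(\<lambda>n. 1 - 3 / real n) \<longlonglongrightarrow> 1 - 0"
    by (intro tendsto_intros lim_const_over_n)
  moreover have "eventually (\<lambda>n. P n \<le> 1) sequentially"
    by (simp add: P_def)
  ultimately have "P \<longlonglongrightarrow> 1"
    using tendsto_sandwich[of "\<lambda>n. 1 - 3 / real n" P sequentially "\<lambda>_. 1" 1] by simp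
  then show ?thesis
    unfolding P_def .
qed

end
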